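(* Starting from a graph with $n$ (fixed) vertices, a Minimal Dominating Set can be deterministically maintained over any sequence of edge insertions and deletions in $O(\sqrt{m})$ amortized time per update, where $m$ is an upper bound on the number of edges in the graph.
   Context: A dynamic graph is a sequence of graphs on a fixed set of $n$ vertices, each obtained from the previous one by inserting or deleting a single edge (an update). A dominating set of a graph $G=(V,E)$ is a set $\mathcal{D}\subseteq V$ such that every vertex of $V$ is in $\mathcal{D}$ or adjacent to a vertex of $\mathcal{D}$. A minimal dominating set is a dominating set from which no vertex can be removed while keeping it a dominating set. Maintaining it means that after every update the algorithm holds a minimal dominating set of the current graph. *)

theory Defs
  imports Complex_Main
begin

text \<open>Finite simple graphs with vertex set \<open>V\<close>; an edge is a two-element set of vertices.\<close>

definition all_edges :: "'a set \<Rightarrow> 'a set set" where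
  "all_edges V = {{u, v} | u v. u \<in> V \<and> v \<in> V \<and> u \<noteq> v}"

definition simple_graph :: "'a set \<Rightarrow> 'a set set \<Rightarrow> bool" where
  "simple_graph V E \<longleftrightarrow> finite V \<and> E \<subseteq> all_edges V"

definition dominating_set :: "'a set \<Rightarrow> 'a set set \<Rightarrow> 'a set \<Rightarrow> bool" where
  "dominating_set V E D \<longleftrightarrow> D \<subseteq> V \<and> (\<forall>v\<in>V. v \<in> D \<or> (\<exists>u\<in>D. {u, v} \<in> E))"

definition minimal_dominating_set :: "'a set \<Rightarrow> 'a set set \<Rightarrow> 'a set \<Rightarrow> bool" where
  "minimal_dominating_set V E D \<longleftrightarrow>
     dominating_set V E D \<and> (\<forall>v\<in>D. \<not> dominating_set V E (D - {v}))"

datatype 'a update = InsertEdge 'a 'a | DeleteEdge 'a 'a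

fun legal_update :: "'a set \<Rightarrow> 'a set set \<Rightarrow> 'a update \<Rightarrow> bool" where
  "legal_update V E (InsertEdge u v) \<longleftrightarrow> {u, v} \<in> all_edges V \<and> {u, v} \<notin> E"
| "legal_update V E (DeleteEdge u v) \<longleftrightarrow> {u, v} \<in> E"

fun apply_update :: "'a update \<Rightarrow> 'a set set \<Rightarrow> 'a set set" where
  "apply_update (InsertEdge u v) E = insert {u, v} E"
| "apply_update (DeleteEdge u v) E = E - {{u, v}}"

fun legal_updates :: "'a set \<Rightarrow> 'a set set \<Rightarrow> 'a update list \<Rightarrow> bool" where
  "legal_updates V E [] \<longleftrightarrow> True"
| "legal_updates V E (x # xs) \<longleftrightarrow> legal_update V E x \<and> legal_updates V (apply_update x E) xs"

text \<open>The dynamic graph: the start graph followed by the graph after each update.\<close>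

fun graph_seq :: "'a set set \<Rightarrow> 'a update list \<Rightarrow> 'a set set list" where
  "graph_seq E [] = [E]"
| "graph_seq E (x # xs) = E # graph_seq (apply_update x E) xs"

text \<open>
  The model of computation is a word RAM, programmed with structured control flow. Registers and
  memory cells hold words, that is, numbers below a bound \<open>W\<close>. Registers are named by
  constants in the program text, so a program uses finitely many of them; memory is addressed
  indirectly through registers. Every instruction and every evaluation of a test takes unit time.
\<close>

record ram_state =
  regs :: "nat \<Rightarrow> nat"
  mem :: "nat \<Rightarrow> nat"

datatype arith_op = Add | Sub | Mul | Div

fun eval_op :: "arith_op \<Rightarrow> nat \<Rightarrow> nat \<Rightarrow> nat" where
  "eval_op Add x y = x + y"
| "eval_op Sub x y = x - y"
| "eval_op Mul x y = x * y"
| "eval_op Div x y = x div y"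

datatype test = Less nat nat | Equal nat nat | NotEqual nat nat

fun holds :: "test \<Rightarrow> ram_state \<Rightarrow> bool" where
  "holds (Less i j) s \<longleftrightarrow> regs s i < regs s j"
| "holds (Equal i j) s \<longleftrightarrow> regs s i = regs s j"
| "holds (NotEqual i j) s \<longleftrightarrow> regs s i \<noteq> regs s j"

datatype com =
    Skip
  | Const nat nat
  | Arith arith_op nat nat nat
  | Load nat nat
  | Store nat nat
  | Seq com com
  | Cond test com com
  | While test com

definition set_reg :: "nat \<Rightarrow> nat \<Rightarrow> ram_state \<Rightarrow> ram_state" where
  "set_reg i x s = s\<lparr>regs := (regs s)(i := x)\<rparr>"

text \<open>
  \<open>exec W c s t s'\<close>: started in \<open>s\<close> on a machine with word bound \<open>W\<close>,
  \<open>c\<close> terminates in \<open>s'\<close> after \<open>t\<close> time units. A computation that produces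
  a number not fitting into a word gets stuck, so it has no execution at all.
\<close>

inductive exec :: "nat \<Rightarrow> com \<Rightarrow> ram_state \<Rightarrow> nat \<Rightarrow> ram_state \<Rightarrow> bool" for W :: nat where
  Skip: "exec W Skip s 1 s"
| Const: "x < W \<Longrightarrow> exec W (Const i x) s 1 (set_reg i x s)"
| Arith: "x = eval_op f (regs s j) (regs s k) \<Longrightarrow> x < W \<Longrightarrow>
    exec W (Arith f i j k) s 1 (set_reg i x s)"
| Load: "exec W (Load i j) s 1 (set_reg i (mem s (regs s j)) s)"
| Store: "exec W (Store i j) s 1 (s\<lparr>mem := (mem s)(regs s i := regs s j)\<rparr>)"
| Seq: "exec W c1 s t1 s' \<Longrightarrow> exec W c2 s' t2 s'' \<Longrightarrow> exec W (Seq c1 c2) s (t1 + t2) s''"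
| CondTrue: "holds b s \<Longrightarrow> exec W c1 s t s' \<Longrightarrow> exec W (Cond b c1 c2) s (1 + t) s'"
| CondFalse: "\<not> holds b s \<Longrightarrow> exec W c2 s t s' \<Longrightarrow> exec W (Cond b c1 c2) s (1 + t) s'"
| WhileFalse: "\<not> holds b s \<Longrightarrow> exec W (While b c) s 1 s"
| WhileTrue: "holds b s \<Longrightarrow> exec W c s t1 s' \<Longrightarrow> exec W (While b c) s' t2 s'' \<Longrightarrow>
    exec W (While b c) s (1 + t1 + t2) s''"

lemma exec_deterministic:
  "exec W c s t s' \<Longrightarrow> exec W c s t' s'' \<Longrightarrow> t' = t \<and> s'' = s'"
proof (induction arbitrary: t' s'' rule: exec.induct)
  case (Seq c1 s t1 s1 c2 t2 s2)
  from Seq.prems show ?case by cases (use Seq.IH in blast)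
next
  case (CondTrue b s c1 t s1 c2)
  from CondTrue.prems show ?case by cases (use CondTrue.IH CondTrue.hyps in blast)+
next
  case (CondFalse b s c2 t s1 c1)
  from CondFalse.prems show ?case by cases (use CondFalse.IH CondFalse.hyps in blast)+
next
  case (WhileFalse b s c)
  from WhileFalse.prems show ?case by cases (use WhileFalse.hyps in blast)+
next
  case (WhileTrue b s c t1 s1 t2 s2)
  from WhileTrue.prems show ?case by cases (use WhileTrue.IH WhileTrue.hyps in blast)+
qed (erule exec.cases; simp)+

text \<open>
  Input: register 0 holds the number \<open>n\<close> of vertices, which are \<open>0, \<dots>, n - 1\<close>,
  and register 1 the number of edges of the start graph. The end points of these edges, in any order
  and orientation, are in consecutive memory cells from address \<open>n\<close> on. Everything else is 0.
\<close>

definition edge_list :: "'a set set \<Rightarrow> ('a \<times> 'a) list \<Rightarrow> bool" where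
  "edge_list E es \<longleftrightarrow>
     distinct (map (\<lambda>(u, v). {u, v}) es) \<and> set (map (\<lambda>(u, v). {u, v}) es) = E"

definition input_state :: "nat \<Rightarrow> (nat \<times> nat) list \<Rightarrow> ram_state" where
  "input_state n es =
     (let xs = concat (map (\<lambda>(u, v). [u, v]) es) in
      \<lparr>regs = (\<lambda>_. 0)(0 := n, 1 := length es),
       mem = (\<lambda>a. if n \<le> a \<and> a < n + length xs then xs ! (a - n) else 0)\<rparr>)"

text \<open>
  An update is passed in registers 0 (1 for an insertion, 0 for a deletion), 1 and 2 (the end
  points); all other registers and the memory are kept from one update to the next.
\<close>

fun pass_update :: "nat update \<Rightarrow> ram_state \<Rightarrow> ram_state" where
  "pass_update (InsertEdge u v) s = set_reg 0 1 (set_reg 1 u (set_reg 2 v s))"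
| "pass_update (DeleteEdge u v) s = set_reg 0 0 (set_reg 1 u (set_reg 2 v s))"

text \<open>
  \<open>serve W c s us ts ss\<close>: starting in \<open>s\<close>, the program \<open>c\<close> processes the updates
  \<open>us\<close> one after the other; \<open>ts\<close> and \<open>ss\<close> are the running times and the
  resulting states.
\<close>

inductive serve ::
  "nat \<Rightarrow> com \<Rightarrow> ram_state \<Rightarrow> nat update list \<Rightarrow> nat list \<Rightarrow> ram_state list \<Rightarrow> bool"
  for W :: nat and c :: com where
  "serve W c s [] [] []"
| "exec W c (pass_update x s) t s' \<Longrightarrow> serve W c s' us ts ss \<Longrightarrow>
    serve W c s (x # us) (t # ts) (s' # ss)"

text \<open>The vertex set held by the machine, as a membership array in cells \<open>0, \<dots>, n - 1\<close>.\<close>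

definition held_set :: "nat \<Rightarrow> ram_state \<Rightarrow> nat set" where
  "held_set n s = {v. v < n \<and> mem s v = 1}"

end

theory Submission
  imports Defs
begin

text \<open>
  Keep, for every vertex \<open>w\<close>, the number and the sum of its dominators (the vertices of the
  dominating set \<open>D\<close> in the closed neighbourhood of \<open>w\<close>), and, for every \<open>x\<close>,
  the number of vertices whose only dominator is \<open>x\<close>. As long as this last number is
  positive for all \<open>x \<in> D\<close> and every vertex has a dominator, \<open>D\<close> is a minimal
  dominating set. The sum of the dominators names the dominator when it is unique, so a single arc
  from a vertex of \<open>D\<close> to a vertex it dominates is added or deleted in constant time, and a
  vertex enters or leaves \<open>D\<close> in time proportional to its degree. With the potential
  \<open>\<Sum>v\<in>D. deg v\<close> the removals of redundant vertices are free: a redundant vertex has a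
  neighbour, so its degree pays for its removal.

  Only edge deletions force vertices into \<open>D\<close>, at most two each. To dominate \<open>z\<close> cheaply,
  scan its neighbours \<open>w\<^sub>0, w\<^sub>1, \<dots>\<close> up to the first one with \<open>deg w\<^sub>i \<le> i\<close> and add
  that one, or \<open>z\<close> itself if there is none. The neighbours passed over have degrees at least
  \<open>1, 2, \<dots>, i\<close>, so \<open>i * (i + 1) \<le> 4 * m\<close>, and the degree of the added vertex is at most
  the number \<open>i\<close> of neighbours passed over.
\<close>

section \<open>Weakest preconditions for the word RAM\<close>

text \<open>Total correctness with time: an execution has to exist, so a program that overflows a
  word or diverges satisfies no postcondition. Because \<open>exec\<close> is deterministic, the
  existential loses nothing against a universal.\<close>

definition wp :: "nat \<Rightarrow> com \<Rightarrow> (nat \<Rightarrow> ram_state \<Rightarrow> bool) \<Rightarrow> ram_state \<Rightarrow> bool" where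
  "wp W c P s \<longleftrightarrow> (\<exists>t s'. exec W c s t s' \<and> P t s')"

inductive_cases Skip_cases: "exec W Skip s t s'"
inductive_cases Const_cases: "exec W (Const i x) s t s'"
inductive_cases Arith_cases: "exec W (Arith f i j k) s t s'"
inductive_cases Load_cases: "exec W (Load i j) s t s'"
inductive_cases Store_cases: "exec W (Store i j) s t s'"
inductive_cases Seq_cases: "exec W (Seq a b) s t s'"
inductive_cases Cond_cases: "exec W (Cond b c1 c2) s t s'"

text \<open>
  With this rule the simplifier leaves the program and the postcondition alone until the program
  reaches them, so that symbolic execution by the \<open>wp\<close> equations proceeds from left to right.
\<close>

lemma wp_cong [cong]: "s = s' \<Longrightarrow> wp W c P s = wp W c P s'"
  by simp

lemma wp_Skip: "wp W Skip P s \<longleftrightarrow> P 1 s"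
  unfolding wp_def by (auto intro: exec.Skip elim!: Skip_cases intro!: exI conjI)

lemma wp_Const: "wp W (Const i x) P s \<longleftrightarrow> x < W \<and> P 1 (set_reg i x s)"
  unfolding wp_def by (auto intro: exec.Const elim!: Const_cases intro!: exI conjI)

lemma wp_Arith:
  "wp W (Arith f i j k) P s \<longleftrightarrow>
    eval_op f (regs s j) (regs s k) < W \<and> P 1 (set_reg i (eval_op f (regs s j) (regs s k)) s)"
  unfolding wp_def by (auto intro: exec.Arith elim!: Arith_cases intro!: exI conjI)

lemma wp_Load: "wp W (Load i j) P s \<longleftrightarrow> P 1 (set_reg i (mem s (regs s j)) s)"
  unfolding wp_def by (auto intro: exec.Load elim!: Load_cases intro!: exI conjI)

lemma wp_Store: "wp W (Store i j) P s \<longleftrightarrow> P 1 (s\<lparr>mem := (mem s)(regs s i := regs s j)\<rparr>)"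
  unfolding wp_def by (auto intro: exec.Store elim!: Store_cases intro!: exI conjI)

lemma wp_Seq:
  "wp W (Seq a b) P s \<longleftrightarrow> wp W a (\<lambda>t s1. wp W b (\<lambda>t' s2. P (t + t') s2) s1) s"
  unfolding wp_def by (blast intro: exec.Seq elim: Seq_cases)

lemma wp_Cond:
  "wp W (Cond b c1 c2) P s \<longleftrightarrow>
    (if holds b s then wp W c1 (\<lambda>t. P (1 + t)) s else wp W c2 (\<lambda>t. P (1 + t)) s)"
  unfolding wp_def
  by (cases "holds b s")
    (auto elim!: Cond_cases; fastforce dest: exec.CondTrue exec.CondFalse)+

text \<open>Well-founded induction on \<open>\<mu>\<close>, generalised over the elapsed time. The
  invariant sees the time spent so far, so costs may be charged to a potential or to a counter other
  than the measure; \<open>\<mu>\<close> serves termination alone. Each round and the exit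
  contribute one unit for the test.\<close>

lemma wp_While:
  fixes \<mu> :: "ram_state \<Rightarrow> nat"
  assumes init: "J 0 s"
    and step: "\<And>t s. J t s \<Longrightarrow> holds b s \<Longrightarrow> wp W c (\<lambda>t' s'. J (t + 1 + t') s' \<and> \<mu> s' < \<mu> s) s"
    and exit: "\<And>t s. J t s \<Longrightarrow> \<not> holds b s \<Longrightarrow> P (t + 1) s"
  shows "wp W (While b c) P s"
proof -
  have "\<exists>t' s'. exec W (While b c) s t' s' \<and> P (t + t') s'" if "J t s" for t s
    using that
  proof (induction "\<mu> s" arbitrary: t s rule: less_induct)
    case less
    show ?case
    proof (cases "holds b s")
      case True
      from step[OF less.prems True] obtain t1 s1 where
        1: "exec W c s t1 s1" "J (t + 1 + t1) s1" "\<mu> s1 < \<mu> s"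
        unfolding wp_def by blast
      from less.hyps[OF 1(3,2)] obtain t2 s2 where
        "exec W (While b c) s1 t2 s2" "P (t + 1 + t1 + t2) s2"
        by blast
      with exec.WhileTrue[OF True 1(1)] show ?thesis
        by (metis add.assoc)
    next
      case False
      then show ?thesis
        using exec.WhileFalse exit[OF less.prems False] by blast
    qed
  qed
  from this[OF init] show ?thesis
    unfolding wp_def by simp
qed

fun writes :: "com \<Rightarrow> nat set" where
  "writes Skip = {}"
| "writes (Const i x) = {i}"
| "writes (Arith f i j k) = {i}"
| "writes (Load i j) = {i}"
| "writes (Store i j) = {}"
| "writes (Seq a b) = writes a \<union> writes b"
| "writes (Cond b c1 c2) = writes c1 \<union> writes c2"
| "writes (While b c) = writes c"

lemma exec_writes: "exec W c s t s' \<Longrightarrow> q \<notin> writes c \<Longrightarrow> regs s' q = regs s q"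
  by (induction rule: exec.induct) (auto simp: set_reg_def)

text \<open>Frame rule: the specification of a subprogram need not mention the registers that only
  its caller uses, since \<open>writes\<close> bounds syntactically what can change.\<close>

lemma wp_call:
  assumes "wp W c P s"
    and "\<And>t s'. P t s' \<Longrightarrow> (\<And>q. q \<notin> writes c \<Longrightarrow> regs s' q = regs s q) \<Longrightarrow> Q t s'"
  shows "wp W c Q s"
  using assms exec_writes unfolding wp_def by blast

section \<open>Arrays in memory and macro instructions for accessing them\<close>

text \<open>
  Memory is divided into arrays of length \<open>n * n\<close>: array 0 is the membership array of the
  dominating set followed by the input, arrays 1 to 4 hold for each vertex its degree, the number of
  its dominators, their sum, and the number of vertices it alone dominates; array 5 holds the
  adjacency lists, \<open>n\<close> cells for each vertex, and array 6 the position of \<open>w\<close> in the list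
  of \<open>v\<close> in cell \<open>v * n + w\<close>. Cutting \<open>arr\<close> off at \<open>n * n\<close> makes an assignment to
  an array element a function update.
\<close>

definition arr :: "nat \<Rightarrow> ram_state \<Rightarrow> nat \<Rightarrow> nat \<Rightarrow> nat" where
  "arr n s k a = (if a < n * n then mem s (k * (n * n) + a) else 0)"

definition upd_arr :: "nat \<Rightarrow> nat \<Rightarrow> nat \<Rightarrow> nat \<Rightarrow> ram_state \<Rightarrow> ram_state" where
  "upd_arr n k a x s = s\<lparr>mem := (mem s)(k * (n * n) + a := x)\<rparr>"

lemma regs_set_reg [simp]: "regs (set_reg i x s) = (regs s)(i := x)"
  by (simp add: set_reg_def)

lemma mem_set_reg [simp]: "mem (set_reg i x s) = mem s"
  by (simp add: set_reg_def)

lemma arr_set_reg [simp]: "arr n (set_reg i x s) = arr n s"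
  by (simp add: arr_def fun_eq_iff)

lemma set_reg_same [simp]: "set_reg i x (set_reg i y s) = set_reg i x s"
  by (simp add: set_reg_def)

lemma regs_upd_arr [simp]: "regs (upd_arr n k a x s) = regs s"
  by (simp add: upd_arr_def)

text \<open>Uniqueness of quotient and remainder. It separates the cells of different arrays, and
  the adjacency rows of different vertices within one array.\<close>

lemma mult_add_eq_iff:
  fixes a b :: nat
  assumes "a < N" "b < N"
  shows "k * N + a = l * N + b \<longleftrightarrow> k = l \<and> a = b"
proof
  assume eq: "k * N + a = l * N + b"
  have "k = (k * N + a) div N" "l = (l * N + b) div N"
    using assms by auto
  with eq show "k = l \<and> a = b" by auto
qed auto

lemma arr_upd_arr [simp]:
  assumes "a < n * n"
  shows "arr n (upd_arr n k a x s) = (arr n s)(k := (arr n s k)(a := x))"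
  using assms by (auto simp: arr_def upd_arr_def fun_eq_iff mult_add_eq_iff)

text \<open>Register 3 holds \<open>n\<close>, register 4 holds \<open>n * n\<close>, and register 5 is scratch.\<close>

definition "MOV d j = Seq (Const 5 0) (Arith Add d j 5)"
definition "INC d = Seq (Const 5 1) (Arith Add d d 5)"
definition "DEC d = Seq (Const 5 1) (Arith Sub d d 5)"
definition "OFF d a b = Seq (Arith Mul 5 a 3) (Arith Add d 5 b)"
definition "ADDR k j = Seq (Const 5 k) (Seq (Arith Mul 5 5 4) (Arith Add 5 5 j))"
definition "LD d k j = Seq (ADDR k j) (Load d 5)"
definition "ST k j v = Seq (ADDR k j) (Store 5 v)"

lemma writes_macros [simp]:
  "writes (MOV d j) = {5, d}" "writes (INC d) = {5, d}" "writes (DEC d) = {5, d}"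
  "writes (OFF d a b) = {5, d}" "writes (LD d k j) = {5, d}" "writes (ST k j v) = {5}"
  by (auto simp: MOV_def INC_def DEC_def OFF_def LD_def ST_def ADDR_def)

text \<open>The bound is \<open>8 * (n + 2) ^ 2\<close> multiplied out. Seven arrays of length
  \<open>n * n\<close> need addresses below \<open>7 * (n * n)\<close>; the rest leaves room for
  sums of dominators, counters and program constants.\<close>

locale word_ram =
  fixes n W :: nat
  assumes W: "8 * (n * n) + 32 * n + 32 \<le> W"
begin

lemma less_W: "x < 8 * (n * n) + 32 * n + 32 \<Longrightarrow> x < W"
  using W by simp

lemma small_W [simp]: "x < n \<Longrightarrow> x < W" "x < n \<Longrightarrow> Suc x < W" "0 < W" "1 < W" "Suc 0 < W"
  using W by auto

lemma less_n_sq [simp]: "x < n \<Longrightarrow> x < n * n"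
  using le_square[of n] by linarith

lemma off_less [simp]: "a < n \<Longrightarrow> b < n \<Longrightarrow> a * n + b < n * n"
proof -
  assume "a < n" "b < n"
  then have "a * n + b < a * n + n" by simp
  also have "a * n + n = Suc a * n" by simp
  also have "\<dots> \<le> n * n" by (rule mult_le_mono1) (use \<open>a < n\<close> in simp)
  finally show ?thesis .
qed

lemma off_less_W [simp]: "a < n \<Longrightarrow> b < n \<Longrightarrow> a * n + b < W"
  by (rule less_W) (use off_less[of a b] in linarith)

lemma wp_MOV:
  "j \<noteq> 5 \<Longrightarrow> wp W (MOV d j) P s \<longleftrightarrow> regs s j < W \<and> P 2 (set_reg d (regs s j) (set_reg 5 0 s))"
  unfolding MOV_def by (simp add: wp_Seq wp_Const wp_Arith numeral_2_eq_2)

lemma wp_INC: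
  "d \<noteq> 5 \<Longrightarrow> wp W (INC d) P s \<longleftrightarrow>
    regs s d + 1 < W \<and> P 2 (set_reg d (regs s d + 1) (set_reg 5 1 s))"
  unfolding INC_def by (simp add: wp_Seq wp_Const wp_Arith numeral_2_eq_2)

lemma wp_DEC:
  "d \<noteq> 5 \<Longrightarrow> wp W (DEC d) P s \<longleftrightarrow>
    regs s d - 1 < W \<and> P 2 (set_reg d (regs s d - 1) (set_reg 5 1 s))"
  unfolding DEC_def by (simp add: wp_Seq wp_Const wp_Arith numeral_2_eq_2)

lemma wp_OFF:
  assumes "a \<noteq> 5" "b \<noteq> 5" "regs s 3 = n" "regs s a < n" "regs s b < n"
  shows "wp W (OFF d a b) P s \<longleftrightarrow>
    P 2 (set_reg d (regs s a * n + regs s b) (set_reg 5 (regs s a * n) s))"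
proof -
  have "regs s a * n + regs s b < W" using assms by simp
  then have "regs s a * n < W" by simp
  with assms show ?thesis
    unfolding OFF_def by (simp add: wp_Seq wp_Const wp_Arith numeral_2_eq_2)
qed

lemma addr_W:
  assumes "k < 7" "a < n * n"
  shows "k * (n * n) + a < W"
proof -
  have "k * (n * n) \<le> 6 * (n * n)" by (rule mult_le_mono1) (use assms in simp)
  with assms show ?thesis by (intro less_W) linarith
qed

lemma wp_ADDR:
  assumes "j \<noteq> 5" "k < 7" "regs s 4 = n * n" "regs s j < n * n"
  shows "wp W (ADDR k j) P s \<longleftrightarrow>
    P 3 (set_reg 5 (k * (n * n) + regs s j) (set_reg 5 (k * (n * n)) (set_reg 5 k s)))"
proof -
  have "k * (n * n) + regs s j < W" using addr_W assms by simp
  then have "k * (n * n) < W" by linarith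
  moreover have "k < W" using assms W by simp
  ultimately show ?thesis
    using assms addr_W[of k "regs s j"]
    unfolding ADDR_def by (simp add: wp_Seq wp_Const wp_Arith numeral_3_eq_3)
qed

lemma wp_LD:
  assumes "j \<noteq> 5" "k < 7" "regs s 4 = n * n" "regs s j < n * n"
  shows "wp W (LD d k j) P s \<longleftrightarrow>
    P 4 (set_reg d (arr n s k (regs s j)) (set_reg 5 (k * (n * n) + regs s j) s))"
  using assms unfolding LD_def by (simp add: wp_Seq wp_ADDR wp_Load arr_def)

lemma wp_ST:
  assumes "j \<noteq> 5" "v \<noteq> 5" "k < 7" "regs s 4 = n * n" "regs s j < n * n"
  shows "wp W (ST k j v) P s \<longleftrightarrow>
    P 4 (upd_arr n k (regs s j) (regs s v) (set_reg 5 (k * (n * n) + regs s j) s))"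
  using assms unfolding ST_def by (simp add: wp_Seq wp_ADDR wp_Store upd_arr_def)

lemmas wp_simps =
  wp_Skip wp_Const wp_Arith wp_Seq wp_Cond wp_MOV wp_INC wp_DEC wp_OFF wp_LD wp_ST

end

section \<open>Representation of the graph and of the dominators\<close>

definition priv :: "nat \<Rightarrow> (nat \<Rightarrow> nat set) \<Rightarrow> nat \<Rightarrow> nat" where
  "priv n I x = card {w. w < n \<and> I w = {x}}"

text \<open>Only \<open>w\<close> can change its status, and the remaining vertices are counted
  alike on both sides. The additive form avoids truncated subtraction and covers gain and loss at
  once.\<close>

lemma priv_fun_upd:
  assumes "w < n"
  shows "priv n (I(w := X)) x + of_bool (I w = {x}) = priv n I x + of_bool (X = {x})"
proof -
  let ?A = "{v. v < n \<and> v \<noteq> w \<and> I v = {x}}"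
  have "{v. v < n \<and> I v = {x}} = (if I w = {x} then insert w ?A else ?A)"
    and "{v. v < n \<and> (I(w := X)) v = {x}} = (if X = {x} then insert w ?A else ?A)"
    using assms by auto
  then show ?thesis
    unfolding priv_def by (simp split: if_splits)
qed

lemma priv_pos_iff: "0 < priv n I x \<longleftrightarrow> (\<exists>w<n. I w = {x})"
  unfolding priv_def by (auto simp: card_gt_0_iff)

lemma priv_le: "priv n I x \<le> n"
proof -
  have "priv n I x \<le> card {..<n}"
    unfolding priv_def by (intro card_mono) auto
  then show ?thesis by simp
qed

text \<open>An adjacency list with an inverse index: on the first \<open>dg v\<close> cells of a
  row, \<open>nb\<close> and \<open>ix\<close> are inverse to each other, so every out-neighbour is
  listed exactly once and can be located in constant time. All other cells may hold stale
  values.\<close>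

definition adjrep ::
  "nat \<Rightarrow> (nat \<times> nat) set \<Rightarrow> (nat \<Rightarrow> nat) \<Rightarrow> (nat \<Rightarrow> nat) \<Rightarrow> (nat \<Rightarrow> nat) \<Rightarrow> bool" where
  "adjrep n F dg nb ix \<longleftrightarrow> F \<subseteq> {..<n} \<times> {..<n} \<and>
     (\<forall>v<n. \<forall>i<dg v. (v, nb (v * n + i)) \<in> F \<and> ix (v * n + nb (v * n + i)) = i) \<and>
     (\<forall>v w. (v, w) \<in> F \<longrightarrow> ix (v * n + w) < dg v \<and> nb (v * n + ix (v * n + w)) = w)"

definition domrep ::
  "nat \<Rightarrow> (nat \<Rightarrow> nat set) \<Rightarrow> (nat \<Rightarrow> nat) \<Rightarrow> (nat \<Rightarrow> nat) \<Rightarrow> (nat \<Rightarrow> nat) \<Rightarrow> bool" where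
  "domrep n I ct sm pr \<longleftrightarrow>
     (\<forall>w<n. I w \<subseteq> {..<n} \<and> ct w = card (I w) \<and> sm w = \<Sum>(I w) \<and> pr w = priv n I w)"

text \<open>\<open>inp\<close> is the part of the input that follows the membership array.\<close>

definition setrep :: "nat \<Rightarrow> nat set \<Rightarrow> (nat \<Rightarrow> nat) \<Rightarrow> (nat \<Rightarrow> nat) \<Rightarrow> bool" where
  "setrep n D inp b \<longleftrightarrow> D \<subseteq> {..<n} \<and> (\<forall>v. b v = (if v < n then of_bool (v \<in> D) else inp v))"

text \<open>
  The arc arguments are in registers 10 and 11 for additions and in registers 16 and 17 for
  deletions. An addition leaves in register 12 the vertex that ceases to be the only dominator of
  the target, if there is one, and the target otherwise.
\<close>

definition ADDARC :: com where
  "ADDARC = Seq (MOV 12 11) (Seq (LD 6 2 11) (Seq (Const 7 1)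
    (Seq (Cond (Equal 6 7)
       (Seq (LD 12 3 11) (Seq (LD 8 4 12) (Seq (Arith Sub 8 8 7) (ST 4 12 8)))) Skip)
    (Seq (Arith Add 6 6 7) (Seq (ST 2 11 6)
    (Seq (Cond (Equal 6 7)
       (Seq (LD 8 4 10) (Seq (Arith Add 8 8 7) (ST 4 10 8))) Skip)
    (Seq (LD 8 3 11) (Seq (Arith Add 8 8 10) (ST 3 11 8)))))))))"

definition DELARC :: com where
  "DELARC = Seq (LD 6 2 17) (Seq (Const 7 1) (Seq (Arith Sub 6 6 7) (Seq (ST 2 17 6)
    (Seq (LD 8 3 17) (Seq (Arith Sub 8 8 16) (Seq (ST 3 17 8)
    (Cond (Equal 6 7)
      (Seq (LD 6 4 8) (Seq (Arith Add 6 6 7) (ST 4 8 6)))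
      (Cond (Less 6 7)
        (Seq (LD 6 4 16) (Seq (Arith Sub 6 6 7) (ST 4 16 6))) Skip))))))))"

definition ADDADJ :: com where
  "ADDADJ = Seq (LD 6 1 10) (Seq (OFF 7 10 6) (Seq (ST 5 7 11) (Seq (OFF 7 10 11)
    (Seq (ST 6 7 6) (Seq (INC 6) (ST 1 10 6))))))"

definition DELADJ :: com where
  "DELADJ = Seq (OFF 6 16 17) (Seq (LD 6 6 6) (Seq (LD 7 1 16) (Seq (DEC 7) (Seq (OFF 8 16 7)
    (Seq (LD 8 5 8) (Seq (OFF 9 16 6) (Seq (ST 5 9 8) (Seq (OFF 9 16 8) (Seq (ST 6 9 6)
    (ST 1 16 7))))))))))"

lemma writes_ADDARC [simp]: "writes ADDARC = {5, 6, 7, 8, 12}"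
  by (auto simp: ADDARC_def)
lemma writes_DELARC [simp]: "writes DELARC = {5, 6, 7, 8}"
  by (auto simp: DELARC_def)
lemma writes_ADDADJ [simp]: "writes ADDADJ = {5, 6, 7}"
  by (auto simp: ADDADJ_def)
lemma writes_DELADJ [simp]: "writes DELADJ = {5, 6, 7, 8, 9}"
  by (auto simp: DELADJ_def)

context word_ram
begin

text \<open>\<open>I\<close> is kept independent of \<open>F\<close> and \<open>D\<close> because
  adjacency lists, counts and membership bits are changed one after the other, through states in
  which they do not agree. \<open>nb\<close> is exposed so that loops can name the list entries they
  visit.\<close>

definition rep ::
  "(nat \<times> nat) set \<Rightarrow> nat set \<Rightarrow> (nat \<Rightarrow> nat set) \<Rightarrow> (nat \<Rightarrow> nat) \<Rightarrow> (nat \<Rightarrow> nat) \<Rightarrow>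
    ram_state \<Rightarrow> bool" where
  "rep F D I inp nb s \<longleftrightarrow> regs s 3 = n \<and> regs s 4 = n * n \<and> irrefl F \<and>
     adjrep n F (arr n s 1) (arr n s 5) (arr n s 6) \<and>
     domrep n I (arr n s 2) (arr n s 3) (arr n s 4) \<and> setrep n D inp (arr n s 0) \<and>
     arr n s 5 = nb"

lemma adjrep_bij:
  assumes "adjrep n F dg nb ix" "v < n"
  shows "bij_betw (\<lambda>i. nb (v * n + i)) {..<dg v} (F `` {v})"
  by (rule bij_betw_byWitness[where f' = "\<lambda>w. ix (v * n + w)"])
    (use assms in \<open>auto simp: adjrep_def\<close>)

lemma adjrep_deg: "adjrep n F dg nb ix \<Longrightarrow> v < n \<Longrightarrow> dg v = card (F `` {v})"
  using bij_betw_same_card[OF adjrep_bij] by simp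

lemma adjrep_deg_le:
  assumes "adjrep n F dg nb ix" "v < n"
  shows "dg v \<le> n"
proof -
  have "card (F `` {v}) \<le> card {..<n}"
    by (rule card_mono) (use assms in \<open>auto simp: adjrep_def\<close>)
  with adjrep_deg[OF assms] show ?thesis by simp
qed

text \<open>Provides the free cell at the end of the row of \<open>v\<close> into which a new arc is
  written.\<close>

lemma adjrep_deg_less:
  assumes "adjrep n F dg nb ix" "v < n" "w < n" "(v, w) \<notin> F"
  shows "dg v < n"
proof -
  have "card (F `` {v}) < card {..<n}"
    by (rule psubset_card_mono) (use assms in \<open>auto simp: adjrep_def\<close>)
  with adjrep_deg[OF assms(1,2)] show ?thesis by simp
qed

lemma sum_less:
  assumes "X \<subseteq> {..<n}" "w < n"
  shows "\<Sum>X < n * n"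
proof -
  have "\<Sum>X \<le> \<Sum>{..<n}" by (rule sum_mono2) (use assms in auto)
  also have "\<dots> \<le> card {..<n} * (n - 1)"
    using sum_bounded_above[of "{..<n}" "\<lambda>x. x" "n - 1"] by auto
  also have "\<dots> < n * n" using assms by simp
  finally show ?thesis .
qed

lemma le_W [simp]: "x \<le> n \<Longrightarrow> x + 1 < W" "x \<le> n \<Longrightarrow> Suc x < W" "x \<le> n \<Longrightarrow> x < W"
  using W by auto

lemma sum_W: "x < n * n \<Longrightarrow> y < n \<Longrightarrow> x + y < W"
  using W by auto

lemma off_eq_iff [simp]: "a < n \<Longrightarrow> b < n \<Longrightarrow> c < n \<Longrightarrow> d < n \<Longrightarrow>
    a * n + b = c * n + d \<longleftrightarrow> a = c \<and> b = d"
  by (simp add: mult_add_eq_iff)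

lemma card_gt_1_neq: "1 < card X \<Longrightarrow> X \<noteq> {v}"
  by auto

section \<open>Constant-time changes of one arc in the adjacency lists and in the dominator
  counts\<close>

lemma wp_ADDADJ:
  assumes "rep F D I inp nb s" and [simp]: "regs s 10 = x" "regs s 11 = w"
    and [simp]: "x < n" "w < n" "x \<noteq> w" and new: "(x, w) \<notin> F"
  shows "wp W ADDADJ (\<lambda>t s'. (\<exists>nb'. rep (insert (x, w) F) D I inp nb' s') \<and> t \<le> 30) s"
proof -
  from assms have [simp]: "regs s 3 = n" "regs s 4 = n * n" and adj: "adjrep n F (arr n s 1) (arr n s 5) (arr n s 6)"
    by (auto simp: rep_def)
  have d: "arr n s 1 x < n" by (rule adjrep_deg_less[OF adj _ _ new]) simp_all
  then have [simp]: "Suc (arr n s 1 x) < W" by simp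
  have other: "domrep n I (arr n s 2) (arr n s 3) (arr n s 4)" "irrefl F" "setrep n D inp (arr n s 0)"
    using assms by (auto simp: rep_def)
  define a where "a = arr n s"
  \<comment> \<open>The arrays after the run: \<open>w\<close> is appended at the end of the list of
    \<open>x\<close>, and its position is recorded.\<close>
  define b where "b = a(5 := (a 5)(x * n + a 1 x := w), 6 := (a 6)(x * n + w := a 1 x),
    1 := (a 1)(x := Suc (a 1 x)))"
  have F: "v < n" "u < n" if "(v, u) \<in> F" for v u
    using that adj by (auto simp: adjrep_def)
  have le: "a 1 v \<le> n" if "v < n" for v
    using adjrep_deg_le[OF adj that] by (simp add: a_def)
  have "adjrep n (insert (x, w) F) (b 1) (b 5) (b 6)"
    unfolding adjrep_def
  proof (intro conjI allI impI, goal_cases)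
    case 1
    then show ?case using adj by (auto simp: adjrep_def)
  next
    case (2 v i)
    show ?case
    proof (cases "v = x \<and> i = a 1 x")
      case True
      then show ?thesis using d by (simp add: b_def a_def)
    next
      case False
      with 2 have i: "i < a 1 v" by (auto simp: b_def split: if_splits)
      with 2 le[of v] have "i < n" by linarith
      with False 2 d i adj show ?thesis by (auto simp: b_def a_def adjrep_def)
    qed
  next
    case (3 v i)
    show ?case
    proof (cases "v = x \<and> i = a 1 x")
      case True
      then show ?thesis using d by (simp add: b_def a_def)
    next
      case False
      with 3 have i: "i < a 1 v" by (auto simp: b_def split: if_splits)
      with 3 le[of v] have "i < n" by linarith
      moreover have *: "(v, a 5 (v * n + i)) \<in> F" "a 6 (v * n + a 5 (v * n + i)) = i"
        using adj i 3 by (auto simp: adjrep_def a_def)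
      \<comment> \<open>An old list entry never points to the overwritten index cell, because the
        arc \<open>(x, w)\<close> is new.\<close>
      moreover have "a 5 (v * n + i) < n" "\<not> (v = x \<and> a 5 (v * n + i) = w)"
        using F[OF *(1)] * new by auto
      ultimately show ?thesis using False 3 d i by (auto simp: b_def a_def)
    qed
  next
    case (4 v u)
    show ?case
    proof (cases "v = x \<and> u = w")
      case True
      then show ?thesis by (simp add: b_def)
    next
      case False
      with 4 have *: "(v, u) \<in> F" by auto
      with F adj False show ?thesis by (auto simp: b_def a_def adjrep_def less_SucI)
    qed
  next
    case (5 v u)
    show ?case
    proof (cases "v = x \<and> u = w")
      case True
      then show ?thesis by (simp add: b_def)
    next
      case False
      with 5 have *: "(v, u) \<in> F" by auto
      then have lt: "a 6 (v * n + u) < a 1 v" "a 5 (v * n + a 6 (v * n + u)) = u"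
        using adj by (auto simp: a_def adjrep_def)
      with le[of v] F[OF *] have "a 6 (v * n + u) < n" by linarith
      with F[OF *] lt False d show ?thesis by (auto simp: b_def a_def)
    qed
  qed
  then have "wp W ADDADJ (\<lambda>t s'. rep (insert (x, w) F) D I inp (b 5) s' \<and> t \<le> 30) s"
    unfolding ADDADJ_def using d other
    by (simp add: wp_simps rep_def b_def a_def irrefl_def)
  then show ?thesis by (rule wp_call) blast
qed

text \<open>The gap at position \<open>p\<close> is filled with the last entry \<open>z\<close> of
  the list, so nothing else has to move.\<close>

lemma wp_DELADJ:
  assumes "rep F D I inp nb s" and [simp]: "regs s 16 = x" "regs s 17 = w" and xw: "(x, w) \<in> F"
  shows "wp W DELADJ (\<lambda>t s'. (\<exists>nb'. rep (F - {(x, w)}) D I inp nb' s') \<and> t \<le> 40) s"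
proof -
  from assms have [simp]: "regs s 3 = n" "regs s 4 = n * n"
    and adj: "adjrep n F (arr n s 1) (arr n s 5) (arr n s 6)"
    by (auto simp: rep_def)
  have other: "domrep n I (arr n s 2) (arr n s 3) (arr n s 4)" "irrefl F" "setrep n D inp (arr n s 0)"
    using assms by (auto simp: rep_def)
  define a where "a = arr n s"
  note adj = adj[folded a_def]
  have F: "v < n" "u < n" if "(v, u) \<in> F" for v u
    using that adj by (auto simp: adjrep_def)
  have [simp]: "x < n" "w < n" using F[OF xw] by auto
  define p l z where "p = a 6 (x * n + w)" and "l = a 1 x - 1" and "z = a 5 (x * n + l)"
  have le: "a 1 v \<le> n" if "v < n" for v
    using adjrep_deg_le[OF adj that] .
  have p: "p < a 1 x" "a 5 (x * n + p) = w"
    using adj xw by (auto simp: adjrep_def p_def)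
  then have pl: "p \<le> l" "l < a 1 x" "a 1 x = Suc l" by (auto simp: l_def)
  have [simp]: "l < n" "p < n" using pl le[of x] by auto
  have z: "(x, z) \<in> F" "a 6 (x * n + z) = l"
    using adj pl by (auto simp: adjrep_def z_def)
  have [simp]: "z < n" using F[OF z(1)] by auto
  define b where "b = a(5 := (a 5)(x * n + p := z), 6 := (a 6)(x * n + z := p),
    1 := (a 1)(x := l))"
  have nb: "(v, a 5 (v * n + i)) \<in> F" "a 6 (v * n + a 5 (v * n + i)) = i" "a 5 (v * n + i) < n" "i < n"
    if "v < n" "i < a 1 v" for v i
  proof -
    show "(v, a 5 (v * n + i)) \<in> F" "a 6 (v * n + a 5 (v * n + i)) = i"
      using adj that by (auto simp: adjrep_def)
    then show "a 5 (v * n + i) < n" using F by blast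
    show "i < n" using le that by fastforce
  qed
  have ix: "a 6 (v * n + u) < a 1 v" "a 5 (v * n + a 6 (v * n + u)) = u" "v < n" "u < n" "a 6 (v * n + u) < n"
    if "(v, u) \<in> F" for v u
  proof -
    show 1: "a 6 (v * n + u) < a 1 v" "a 5 (v * n + a 6 (v * n + u)) = u"
      using adj that by (auto simp: adjrep_def)
    show 2: "v < n" "u < n" using F that by blast+
    show "a 6 (v * n + u) < n" using 1 le[OF 2(1)] by linarith
  qed
  have "adjrep n (F - {(x, w)}) (b 1) (b 5) (b 6)"
    unfolding adjrep_def
  proof (intro conjI allI impI, goal_cases)
    case 1
    then show ?case using adj by (auto simp: adjrep_def)
  next
    case (2 v i)
    then have i: "i < a 1 v" using pl by (auto simp: b_def split: if_splits)
    have "v = x \<Longrightarrow> i < l" using 2 by (auto simp: b_def)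
    \<comment> \<open>If the deleted entry is itself the last one, it is copied onto itself in a
      cell that is then cut off; so a surviving position \<open>p\<close> never receives
      \<open>w\<close>.\<close>
    have zw: "z = w \<Longrightarrow> p = l" using z(2) p_def by simp
    show ?case
    proof (cases "v = x \<and> i = p")
      case True
      with \<open>v = x \<Longrightarrow> i < l\<close> z zw show ?thesis by (auto simp: b_def)
    next
      case False
      moreover have "(v, a 5 (v * n + i)) \<noteq> (x, w)"
        using False nb(2)[OF 2(1) i] p_def by auto
      ultimately show ?thesis using nb[OF 2(1) i] 2(1) by (auto simp: b_def)
    qed
  next
    case (3 v i)
    then have i: "i < a 1 v" using pl by (auto simp: b_def split: if_splits)
    have "v = x \<Longrightarrow> i < l" using 3 by (auto simp: b_def)
    show ?case
    proof (cases "v = x \<and> i = p")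
      case True
      then show ?thesis by (simp add: b_def)
    next
      case False
      have "(v, a 5 (v * n + i)) \<noteq> (x, z)"
        using \<open>v = x \<Longrightarrow> i < l\<close> nb(2)[OF 3(1) i] z(2) by auto
      with False show ?thesis using nb[OF 3(1) i] 3(1) by (auto simp: b_def)
    qed
  next
    case (4 v u)
    then have *: "(v, u) \<in> F" by auto
    show ?case
    proof (cases "v = x")
      case False
      with ix[OF *] show ?thesis by (simp add: b_def)
    next
      case [simp]: True
      show ?thesis
      proof (cases "u = z")
        case True
        have "u \<noteq> w" using 4 by simp
        \<comment> \<open>The last entry differs from the deleted one, so its new position
          \<open>p\<close> is strictly below the new length \<open>l\<close>.\<close>
        with True p z_def have "p \<noteq> l" by auto
        with pl True show ?thesis by (simp add: b_def)
      next
        case False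
        \<comment> \<open>Only \<open>z\<close> was stored in the last cell, so every other
          surviving entry stays within the shortened list.\<close>
        then have "a 6 (x * n + u) \<noteq> l" using ix[OF *] z_def by auto
        with ix[OF *] pl False show ?thesis by (simp add: b_def)
      qed
    qed
  next
    case (5 v u)
    then have *: "(v, u) \<in> F" by auto
    have "v = x \<Longrightarrow> u \<noteq> w" using 5 by auto
    moreover have "a 6 (x * n + u) = p \<Longrightarrow> v = x \<Longrightarrow> u = w" using ix[OF *] p by auto
    ultimately show ?case using ix[OF *] pl z p_def[symmetric] by (auto simp: b_def)
  qed
  moreover have [simp]: "arr n s 6 (x * n + w) = p" "arr n s 1 x = Suc l" "arr n s 5 (x * n + l) = z"
    "arr n s (Suc 0) x = Suc l"
    using pl by (auto simp: p_def z_def a_def)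
  ultimately have "wp W DELADJ (\<lambda>t s'. rep (F - {(x, w)}) D I inp (b 5) s' \<and> t \<le> 40) s"
    unfolding DELADJ_def using other
    by (simp add: wp_simps rep_def b_def a_def irrefl_def)
  then show ?thesis by (rule wp_call) blast
qed

text \<open>Exclusive domination is affected only when the number of dominators of \<open>w\<close>
  goes from 0 to 1 or from 1 to 2. In the second case the stored sum is the name of the old
  dominator, whose counter must drop.\<close>

lemma wp_ADDARC:
  assumes "rep F D I inp nb s" and [simp]: "regs s 10 = x" "regs s 11 = w"
    and [simp]: "x < n" "w < n" and new: "x \<notin> I w"
  shows "wp W ADDARC (\<lambda>t s'. rep F D (I(w := insert x (I w))) inp nb s' \<and>
    regs s' 12 < n \<and> (\<forall>y. I w = {y} \<longrightarrow> regs s' 12 = y) \<and> t \<le> 60) s"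
proof -
  define a where "a = arr n s"
  from assms have [simp]: "regs s 3 = n" "regs s 4 = n * n"
    and dom: "domrep n I (a 2) (a 3) (a 4)"
    by (auto simp: rep_def a_def)
  let ?I = "I(w := insert x (I w))"
  have sub: "I v \<subseteq> {..<n}" "finite (I v)" "a 2 v = card (I v)" "a 3 v = \<Sum>(I v)" "a 4 v = priv n I v"
    if "v < n" for v
    using dom that finite_subset[of "I v" "{..<n}"] by (auto simp: domrep_def)
  have pr: "priv n ?I v + of_bool (I w = {v}) = priv n I v + of_bool (insert x (I w) = {v})" for v
    by (rule priv_fun_upd) simp
  have c: "card (I w) \<le> n" using card_mono[OF _ sub(1)[of w]] by simp
  have [simp]: "\<Sum>(I w) + x < W" by (rule sum_W) (use sum_less[OF sub(1)[of w], of w] in auto)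
  have ins: "card (insert x (I w)) = Suc (card (I w))" "\<Sum>(insert x (I w)) = \<Sum>(I w) + x"
    using sub(2)[of w] new by auto
  have [simp]: "arr n s 2 w = card (I w)" "arr n s 3 w = \<Sum>(I w)"
    using sub[of w] by (auto simp: a_def)
  have [simp]: "arr n s 4 v = priv n I v" if "v < n" for v using sub(5)[OF that] by (simp add: a_def)
  have other: "adjrep n F (arr n s 1) (arr n s 5) (arr n s 6)" "irrefl F" "setrep n D inp (arr n s 0)"
    "arr n s 5 = nb"
    using assms by (auto simp: rep_def)
  consider "I w = {}" | y where "I w = {y}" "y < n" "x \<noteq> y" "insert x (I w) = {x, y}" | "card (I w) > 1"
  proof (cases "card (I w) = 1")
    case True
    then obtain y where "I w = {y}" by (auto simp: card_1_singleton_iff)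
    with that(2)[of y] new sub(1)[of w] show ?thesis by auto
  next
    case False
    then consider "card (I w) = 0" | "card (I w) > 1" by linarith
    then show ?thesis by cases (use that sub(2)[of w] in auto)
  qed
  then show ?thesis
  proof cases
    case 1
    have "domrep n ?I ((a 2)(w := 1)) ((a 3)(w := x)) ((a 4)(x := Suc (priv n I x)))"
      unfolding domrep_def using sub pr[unfolded 1] 1 by (auto split: if_splits)
    then show ?thesis
      unfolding ADDARC_def using 1 other priv_le[of n I x] by (simp add: wp_simps rep_def a_def)
  next
    case 2
    have p: "priv n ?I y = priv n I y - 1" "0 < priv n I y"
      using pr[of y] 2 by (auto simp: doubleton_eq_iff)
    moreover have "priv n ?I v = priv n I v" if "v \<noteq> y" for v
      using pr[of v] 2 that by (auto simp: doubleton_eq_iff)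
    ultimately have "domrep n ?I ((a 2)(w := Suc (Suc 0))) ((a 3)(w := y + x)) ((a 4)(y := priv n I y - 1))"
      unfolding domrep_def using sub ins 2 by auto
    then show ?thesis
      unfolding ADDARC_def using 2 other priv_le[of n I y] sum_W[of y x]
      by (simp add: wp_simps rep_def a_def)
  next
    case 3
    have "insert x (I w) \<noteq> {v}" "I w \<noteq> {v}" for v
      using card_gt_1_neq[of "I w"] card_gt_1_neq[of "insert x (I w)"] 3 ins(1) by auto
    note neq = this
    then have "priv n ?I v = priv n I v" for v
      using pr[of v] by simp
    then have "domrep n ?I ((a 2)(w := Suc (card (I w)))) ((a 3)(w := \<Sum>(I w) + x)) (a 4)"
      unfolding domrep_def using sub ins by auto
    then show ?thesis
      unfolding ADDARC_def using 3 other c neq by (simp add: wp_simps rep_def a_def)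
  qed
qed

text \<open>The reverse of an addition: with two dominators, the sum left after subtracting
  \<open>x\<close> names the one that becomes exclusive; with a single one, \<open>x\<close> itself
  loses \<open>w\<close>.\<close>

lemma wp_DELARC:
  assumes "rep F D I inp nb s" and [simp]: "regs s 16 = x" "regs s 17 = w"
    and [simp]: "w < n" and x: "x \<in> I w"
  shows "wp W DELARC (\<lambda>t s'. rep F D (I(w := I w - {x})) inp nb s' \<and> t \<le> 50) s"
proof -
  define a where "a = arr n s"
  from assms have [simp]: "regs s 3 = n" "regs s 4 = n * n"
    and dom: "domrep n I (a 2) (a 3) (a 4)"
    by (auto simp: rep_def a_def)
  let ?I = "I(w := I w - {x})"
  have sub: "I v \<subseteq> {..<n}" "finite (I v)" "a 2 v = card (I v)" "a 3 v = \<Sum>(I v)" "a 4 v = priv n I v"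
    if "v < n" for v
    using dom that finite_subset[of "I v" "{..<n}"] by (auto simp: domrep_def)
  have [simp]: "x < n" using sub(1)[of w] x by auto
  have pr: "priv n ?I v + of_bool (I w = {v}) = priv n I v + of_bool (I w - {x} = {v})" for v
    by (rule priv_fun_upd) simp
  have c: "card (I w) \<le> n" using card_mono[OF _ sub(1)[of w]] by simp
  have [simp]: "\<Sum>(I w) - x < W" using sum_W[of "\<Sum>(I w)" w] sum_less[OF sub(1)[of w], of w] by auto
  have del: "card (I w - {x}) = card (I w) - 1" "\<Sum>(I w - {x}) = \<Sum>(I w) - x"
    using sub(2)[of w] x by (auto simp: sum_diff1_nat)
  have [simp]: "arr n s 2 w = card (I w)" "arr n s 3 w = \<Sum>(I w)"
    using sub[of w] by (auto simp: a_def)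
  have [simp]: "arr n s 4 v = priv n I v" if "v < n" for v using sub(5)[OF that] by (simp add: a_def)
  have other: "adjrep n F (arr n s 1) (arr n s 5) (arr n s 6)" "irrefl F" "setrep n D inp (arr n s 0)"
    "arr n s 5 = nb"
    using assms by (auto simp: rep_def)
  consider "I w = {x}" | y where "I w = {x, y}" "y < n" "x \<noteq> y" "I w - {x} = {y}" | "card (I w) > 2"
  proof (cases "card (I w - {x}) = 1")
    case True
    then obtain y where "I w - {x} = {y}" by (auto simp: card_1_singleton_iff)
    with that(2)[of y] x sub(1)[of w] show ?thesis by auto
  next
    case False
    then consider "I w - {x} = {}" | "card (I w) > 2"
      using del(1) sub(2)[of w] by (cases "card (I w - {x}) = 0") auto
    then show ?thesis by cases (use that x in auto)
  qed
  then show ?thesis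
  proof cases
    case 1
    have "priv n ?I x = priv n I x - 1" "0 < priv n I x"
      using pr[of x] 1 by auto
    moreover have "priv n ?I v = priv n I v" if "v \<noteq> x" for v
      using pr[of v] 1 that by auto
    ultimately have "domrep n ?I ((a 2)(w := 0)) ((a 3)(w := 0)) ((a 4)(x := priv n I x - 1))"
      unfolding domrep_def using sub 1 by auto
    then show ?thesis
      unfolding DELARC_def using 1 other priv_le[of n I x] by (simp add: wp_simps rep_def a_def)
  next
    case 2
    have p: "priv n ?I y = Suc (priv n I y)"
      using pr[of y] 2 by (auto simp: doubleton_eq_iff)
    moreover have "priv n ?I v = priv n I v" if "v \<noteq> y" for v
      using pr[of v] 2 that by (auto simp: doubleton_eq_iff)
    ultimately have "domrep n ?I ((a 2)(w := 1)) ((a 3)(w := y)) ((a 4)(y := Suc (priv n I y)))"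
      unfolding domrep_def using sub 2 by auto
    then show ?thesis
      unfolding DELARC_def using 2 other priv_le[of n I y] by (simp add: wp_simps rep_def a_def)
  next
    case 3
    have sw: "I w - {x} \<subseteq> {..<n}" using sub(1)[of w] by auto
    have "I w - {x} \<noteq> {v}" "I w \<noteq> {v}" for v
      using card_gt_1_neq[of "I w"] card_gt_1_neq[of "I w - {x}"] 3 del(1) by auto
    note neq = this
    then have "priv n ?I v = priv n I v" for v
      using pr[of v] by simp
    then have "domrep n ?I ((a 2)(w := card (I w) - 1)) ((a 3)(w := \<Sum>(I w) - x)) (a 4)"
      unfolding domrep_def using sub del sw by simp
    moreover have "card (I w) - Suc 0 \<noteq> Suc 0" using 3 by linarith
    ultimately show ?thesis
      unfolding DELARC_def using 3 other c by (simp add: wp_simps rep_def a_def)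
  qed
qed

end

section \<open>Vertices leaving and entering the dominating set\<close>

text \<open>
  The vertex argument is in register 16 for \<open>REMOVE\<close> and \<open>CHECK\<close>, in register 10 for
  \<open>ADD\<close>, and in register 20 for \<open>FIND\<close> and \<open>DOMINATE\<close>. \<open>ADD\<close> sets the membership
  bit last, so that \<open>CHECK\<close> does not remove the vertex that is being added.
\<close>

definition REMOVE_BODY :: com where
  "REMOVE_BODY = Seq (OFF 17 16 14) (Seq (LD 17 5 17) (Seq DELARC (INC 14)))"

definition REMOVE :: com where
  "REMOVE = Seq (Const 6 0) (Seq (ST 0 16 6) (Seq (MOV 17 16) (Seq DELARC
    (Seq (Const 14 0) (Seq (LD 15 1 16) (While (Less 14 15) REMOVE_BODY))))))"

definition CHECK :: com where
  "CHECK = Seq (LD 6 0 16) (Seq (Const 7 1) (Cond (Equal 6 7)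
    (Seq (LD 6 4 16) (Cond (Less 6 7) REMOVE Skip)) Skip))"

definition ADDSTEP :: com where
  "ADDSTEP = Seq ADDARC (Seq (MOV 16 12) CHECK)"

definition ADD_BODY :: com where
  "ADD_BODY = Seq (OFF 11 10 18) (Seq (LD 11 5 11) (Seq ADDSTEP (INC 18)))"

definition ADD :: com where
  "ADD = Seq (MOV 11 10) (Seq ADDSTEP (Seq (Const 18 0) (Seq (LD 19 1 10)
    (Seq (While (Less 18 19) ADD_BODY) (Seq (Const 6 1) (ST 0 10 6))))))"

definition FIND_BODY :: com where
  "FIND_BODY = Seq (OFF 6 20 18) (Seq (LD 6 5 6) (Seq (LD 7 1 6)
    (Cond (Less 18 7) (INC 18) (Seq (MOV 10 6) (Const 19 0)))))"

definition FIND :: com where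
  "FIND = Seq (MOV 10 20) (Seq (Const 18 0) (Seq (LD 19 1 20) (While (Less 18 19) FIND_BODY)))"

definition DOMINATE :: com where
  "DOMINATE = Seq (LD 6 2 20) (Seq (Const 7 0) (Cond (Equal 6 7) (Seq FIND ADD) Skip))"

lemma writes_REMOVE [simp]: "writes REMOVE = {5, 6, 7, 8, 14, 15, 17}"
  by (auto simp: REMOVE_def REMOVE_BODY_def)
lemma writes_CHECK [simp]: "writes CHECK = {5, 6, 7, 8, 14, 15, 17}"
  by (auto simp: CHECK_def)
lemma writes_ADDSTEP [simp]: "writes ADDSTEP = {5, 6, 7, 8, 12, 14, 15, 16, 17}"
  by (auto simp: ADDSTEP_def)
lemma writes_ADD [simp]: "writes ADD = {5, 6, 7, 8, 11, 12, 14, 15, 16, 17, 18, 19}"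
  by (auto simp: ADD_def ADD_BODY_def)
lemma writes_FIND [simp]: "writes FIND = {5, 6, 7, 10, 18, 19}"
  by (auto simp: FIND_def FIND_BODY_def)
lemma writes_DOMINATE [simp]:
  "writes DOMINATE = {5, 6, 7, 8, 10, 11, 12, 14, 15, 16, 17, 18, 19}"
  by (auto simp: DOMINATE_def)

definition pot :: "(nat \<times> nat) set \<Rightarrow> nat set \<Rightarrow> nat" where
  "pot F D = (\<Sum>v\<in>D. card (F `` {v}))"

text \<open>\<open>X\<close> consists of the arcs already present from a vertex that is just entering \<open>D\<close>.\<close>

definition doms :: "(nat \<times> nat) set \<Rightarrow> nat set \<Rightarrow> (nat \<times> nat) set \<Rightarrow> nat \<Rightarrow> nat set" where
  "doms F D X w = {u. u \<in> D \<and> (u = w \<or> (u, w) \<in> F) \<or> (u, w) \<in> X}"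

context word_ram
begin

section \<open>Reading the graph and the neighbourhoods off a represented state\<close>

lemma rep_set_reg [simp]:
  "i \<noteq> 3 \<Longrightarrow> i \<noteq> 4 \<Longrightarrow> rep F D I inp nb (set_reg i x s) = rep F D I inp nb s"
  by (simp add: rep_def)

lemma rep_remove: "rep F D I inp nb s \<Longrightarrow> v < n \<Longrightarrow> rep F (D - {v}) I inp nb (upd_arr n 0 v 0 s)"
  by (auto simp add: rep_def setrep_def)

lemma rep_insert:
  "rep F D I inp nb s \<Longrightarrow> v < n \<Longrightarrow> rep F (insert v D) I inp nb (upd_arr n 0 v (Suc 0) s)"
  by (auto simp add: rep_def setrep_def)

lemma rep_regs: "rep F D I inp nb s \<Longrightarrow> regs s 3 = n" "rep F D I inp nb s \<Longrightarrow> regs s 4 = n * n"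
  by (auto simp: rep_def)

lemma rep_rows:
  assumes "rep F D I inp nb s" "v < n"
  shows "arr n s (Suc 0) v = card (F `` {v})" "arr n s 5 = nb" "arr n s 0 v = of_bool (v \<in> D)"
    "arr n s 2 v = card (I v)" "arr n s 4 v = priv n I v" "finite (I v)"
  using assms adjrep_deg[of F "arr n s 1"] finite_subset[of "I v" "{..<n}"]
  by (auto simp: rep_def setrep_def domrep_def)

lemma rep_graph:
  assumes "rep F D I inp nb s"
  shows "F \<subseteq> {..<n} \<times> {..<n}" "finite F" "irrefl F" "D \<subseteq> {..<n}" "finite D"
proof -
  show "F \<subseteq> {..<n} \<times> {..<n}" "irrefl F" "D \<subseteq> {..<n}"
    using assms by (auto simp: rep_def adjrep_def setrep_def)
  then show "finite F" "finite D" by (meson finite_SigmaI finite_lessThan finite_subset)+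
qed

lemma rep_bij:
  assumes "rep F D I inp nb s" "v < n"
  shows "bij_betw (\<lambda>i. nb (v * n + i)) {..<card (F `` {v})} (F `` {v})"
  using assms adjrep_bij[of F "arr n s 1" "arr n s 5" "arr n s 6" v] rep_rows[OF assms]
  by (simp add: rep_def)

lemma rep_deg_le: "rep F D I inp nb s \<Longrightarrow> v < n \<Longrightarrow> card (F `` {v}) \<le> n"
  using adjrep_deg_le[of F "arr n s 1"] rep_rows(1) by (fastforce simp: rep_def)

lemma rep_nb:
  assumes "rep F D I inp nb s" "v < n" "i < card (F `` {v})"
  shows "(v, nb (v * n + i)) \<in> F" "nb (v * n + i) < n" "i < n"
proof -
  show "(v, nb (v * n + i)) \<in> F"
    using rep_bij[OF assms(1,2)] assms(3) by (auto simp: bij_betw_def)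
  then show "nb (v * n + i) < n" using rep_graph(1)[OF assms(1)] by auto
  show "i < n" using assms rep_deg_le[OF assms(1,2)] by simp
qed

text \<open>The part of the closed neighbourhood treated after \<open>i\<close> loop rounds; the
  vertex itself is treated before the loop.\<close>

definition seen :: "(nat \<Rightarrow> nat) \<Rightarrow> nat \<Rightarrow> nat \<Rightarrow> nat set" where
  "seen nb v i = insert v ((\<lambda>j. nb (v * n + j)) ` {..<i})"

lemma seen_Suc: "seen nb v (Suc i) = insert (nb (v * n + i)) (seen nb v i)"
  by (auto simp: seen_def lessThan_Suc)

lemma seen_0: "seen nb v 0 = {v}"
  by (simp add: seen_def)

lemma seen_all:
  assumes "rep F D I inp nb s" "v < n"
  shows "seen nb v (card (F `` {v})) = insert v (F `` {v})"
  using bij_betw_imp_surj_on[OF rep_bij[OF assms]] by (simp add: seen_def)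

lemma seen_fresh:
  assumes "rep F D I inp nb s" "v < n" "i < card (F `` {v})"
  shows "nb (v * n + i) \<notin> seen nb v i"
proof -
  have "nb (v * n + i) \<noteq> nb (v * n + j)" if "j < i" for j
    using rep_bij[OF assms(1,2)] assms(3) that by (force simp: bij_betw_def inj_on_def)
  moreover have "nb (v * n + i) \<noteq> v"
    using rep_nb(1)[OF assms] rep_graph(3)[OF assms(1)] by (metis irrefl_def)
  ultimately show ?thesis by (auto simp: seen_def)
qed

lemma seen_sub:
  assumes "rep F D I inp nb s" "v < n" "i \<le> card (F `` {v})" "w \<in> seen nb v i"
  shows "w = v \<or> (v, w) \<in> F"
  using assms rep_nb(1)[OF assms(1,2)] by (auto simp: seen_def)

section \<open>Removing, checking and adding a vertex, with amortised cost\<close>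

lemma wp_REMOVE:
  assumes rep: "rep F D I inp nb s" and [simp]: "regs s 16 = y" "y < n"
    and full: "\<And>w. y \<in> I w \<longleftrightarrow> w = y \<or> (y, w) \<in> F"
  shows "wp W REMOVE (\<lambda>t s'. rep F (D - {y}) (\<lambda>w. I w - {y}) inp nb s' \<and>
    t \<le> 70 * card (F `` {y}) + 80) s"
proof -
  define d where "d = card (F `` {y})"
  \<comment> \<open>\<open>J i\<close> are the dominators when \<open>y\<close> has been withdrawn
    from itself and from its first \<open>i\<close> listed neighbours.\<close>
  define J where "J i w = (if w \<in> seen nb y i then I w - {y} else I w)" for i w
  have J0: "J 0 = I(y := I y - {y})"
    by (auto simp: J_def seen_0 fun_eq_iff)
  have Jd: "J d = (\<lambda>w. I w - {y})"
    using full by (auto simp: J_def d_def seen_all[OF rep] fun_eq_iff)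
  have loop: "wp W (While (Less 14 15) REMOVE_BODY)
      (\<lambda>t s'. rep F (D - {y}) (\<lambda>w. I w - {y}) inp nb s' \<and> t \<le> 70 * d + 1) s1"
    if "rep F (D - {y}) (J 0) inp nb s1" "regs s1 14 = 0" "regs s1 15 = d" "regs s1 16 = y" for s1
  proof (rule wp_While[where J = "\<lambda>t s'. \<exists>i\<le>d. regs s' 14 = i \<and> regs s' 15 = d \<and> regs s' 16 = y
        \<and> rep F (D - {y}) (J i) inp nb s' \<and> t \<le> 70 * i" and \<mu> = "\<lambda>s'. d - regs s' 14"], goal_cases)
    case 1
    show ?case using that by auto
  next
    case (2 t s2)
    then obtain i where i: "i < d" and [simp]: "regs s2 14 = i" "regs s2 15 = d" "regs s2 16 = y"
      and r: "rep F (D - {y}) (J i) inp nb s2" and t: "t \<le> 70 * i"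
      by auto
    note nb = rep_nb[OF r \<open>y < n\<close> i[unfolded d_def]]
    have [simp]: "i < n" "nb (y * n + i) < n" using nb by auto
    have [simp]: "regs s2 3 = n" "regs s2 4 = n * n" "arr n s2 5 = nb"
      using rep_regs[OF r] rep_rows(2)[OF r \<open>y < n\<close>] by auto
    let ?w = "nb (y * n + i)"
    \<comment> \<open>List entries are distinct and \<open>F\<close> is irreflexive, so
      \<open>y\<close> has not yet been withdrawn from the current neighbour.\<close>
    have "y \<in> J i ?w"
      using seen_fresh[OF r, of y i] nb(1) i full by (auto simp: J_def d_def)
    moreover have "J (Suc i) = (J i)(?w := J i ?w - {y})"
      by (auto simp: J_def seen_Suc fun_eq_iff)
    ultimately show ?case
      unfolding REMOVE_BODY_def
      using r t i
      apply (simp add: wp_simps)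
      apply (rule wp_call[OF wp_DELARC[where x = y and w = ?w and F = F and D = "D - {y}"
              and I = "J i" and inp = inp and nb = nb]])
           apply (auto simp add: wp_simps)
      done
  next
    case (3 t s2)
    then show ?case using Jd by auto
  qed
  have [simp]: "regs s 3 = n" "regs s 4 = n * n" using rep_regs[OF rep] by auto
  show ?thesis
    unfolding REMOVE_def
    apply (simp add: wp_simps)
    apply (rule wp_call[OF wp_DELARC[where x = y and w = y and F = F and D = "D - {y}"
            and I = I and inp = inp and nb = nb]])
         apply (use rep full in \<open>auto simp add: rep_remove\<close>)[5]
    subgoal for t s1
      using rep_regs(2)[of F "D - {y}" "I(y := I y - {y})" inp nb s1]
        rep_rows(1)[of F "D - {y}" "I(y := I y - {y})" inp nb s1 y]
      apply (simp add: wp_simps)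
      apply (rule wp_call[OF loop])
      apply (auto simp: J0 d_def)
      done
    done
qed

text \<open>Minimality with exceptions: the vertices of \<open>Y\<close> may have lost their last
  exclusively dominated vertex and still await a check.\<close>

definition needed ::
  "(nat \<times> nat) set \<Rightarrow> nat set \<Rightarrow> (nat \<times> nat) set \<Rightarrow> nat set \<Rightarrow> bool" where
  "needed F D X Y \<longleftrightarrow> (\<forall>u\<in>D - Y. \<exists>w<n. doms F D X w = {u})"

definition covered :: "(nat \<times> nat) set \<Rightarrow> nat set \<Rightarrow> (nat \<times> nat) set \<Rightarrow> nat set" where
  "covered F D X = {w. w < n \<and> doms F D X w \<noteq> {}}"

lemma pot_remove: "finite D \<Longrightarrow> y \<in> D \<Longrightarrow> pot F D = card (F `` {y}) + pot F (D - {y})"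
  by (simp add: pot_def sum.remove)

lemma pot_insert: "finite D \<Longrightarrow> y \<notin> D \<Longrightarrow> pot F (insert y D) = card (F `` {y}) + pot F D"
  by (simp add: pot_def)

lemma card_gt_0_D: "finite X \<Longrightarrow> x \<in> X \<Longrightarrow> 1 \<le> card X"
  by (metis One_nat_def Suc_leI card_gt_0_iff empty_iff)

text \<open>A removed \<open>y\<close> is nobody's only dominator, so nothing becomes uncovered, and
  sets \<open>{v}\<close> of dominators with \<open>v \<noteq> y\<close> persist. One unit of
  potential pays for 160 time units: with degree \<open>d \<ge> 1\<close>, the cost of at most
  \<open>70 * d + 95\<close> plus overhead is below the \<open>160 * d\<close> released plus
  20.\<close>

lemma wp_CHECK:
  assumes rep: "rep F D (doms F D X) inp nb s" and y [simp]: "regs s 16 = y" "y < n" and "sym F"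
    and X: "X \<subseteq> Id \<union> F" "D \<inter> Domain X = {}" and need: "needed F D X Y"
  shows "wp W CHECK (\<lambda>t s'. \<exists>D'\<subseteq>D. rep F D' (doms F D' X) inp nb s' \<and> needed F D' X (Y - {y}) \<and>
     covered F D X \<subseteq> covered F D' X \<and>
     t + 160 * pot F D' \<le> 160 * pot F D + 20) s"
proof -
  let ?I = "doms F D X"
  note rows = rep_rows[OF rep y(2)]
  have [simp]: "regs s 3 = n" "regs s 4 = n * n" using rep_regs[OF rep] by auto
  \<comment> \<open>If \<open>y\<close> stays in \<open>D\<close>, its positive counter yields the
    witness that lifts its exemption.\<close>
  have keep: "?thesis" if "y \<in> D \<Longrightarrow> 0 < priv n ?I y"
  proof -
    have "needed F D X (Y - {y})"
      using need that unfolding needed_def priv_pos_iff by blast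
    with that show ?thesis
      unfolding CHECK_def using rep rows
      by (auto simp: wp_simps intro!: exI[of _ D])
  qed
  show ?thesis
  proof (cases "y \<in> D \<and> priv n ?I y = 0")
    case False
    then show ?thesis by (intro keep) auto
  next
    case True
    then have [simp]: "y \<in> D" "priv n ?I y = 0" by auto
    have red: "?I w \<noteq> {y}" if "w < n" for w
      using True priv_pos_iff[of n ?I y] that by auto
    \<comment> \<open>The arcs in \<open>X\<close> start at the vertex being added, which is not in
      \<open>D\<close>; hence all contributions of \<open>y\<close> come from its closed
      neighbourhood in \<open>F\<close>.\<close>
    have yX: "(y, w) \<notin> X" for w using X(2) True by blast
    have full: "y \<in> ?I w \<longleftrightarrow> w = y \<or> (y, w) \<in> F" for w
      using yX by (auto simp: doms_def)
    have I': "(\<lambda>w. ?I w - {y}) = doms F (D - {y}) X"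
      using yX by (auto simp: doms_def fun_eq_iff)
    \<comment> \<open>\<open>y\<close> dominates itself but not exclusively, so it has a second
      dominator; by symmetry of \<open>F\<close> that one is a neighbour, and the degree of
      \<open>y\<close> is positive.\<close>
    have "?I y \<noteq> {y}" by (rule red) simp
    then obtain u where "u \<in> ?I y" "u \<noteq> y" using full[of y] by auto
    with X(1) have "(u, y) \<in> F" by (auto simp: doms_def)
    with \<open>sym F\<close> have "u \<in> F `` {y}" by (auto dest: symD)
    moreover have "finite (F `` {y})" using rep_graph(2)[OF rep] by (simp add: finite_Image)
    ultimately have d: "1 \<le> card (F `` {y})" by (intro card_gt_0_D)
    have "needed F (D - {y}) X (Y - {y})"
      unfolding needed_def I'[symmetric]
    proof
      fix v assume v: "v \<in> D - {y} - (Y - {y})"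
      with need obtain w where "w < n" "?I w = {v}" unfolding needed_def by blast
      with v show "\<exists>w<n. ?I w - {y} = {v}" by (intro exI[of _ w]) auto
    qed
    moreover have "covered F D X \<subseteq> covered F (D - {y}) X"
      unfolding covered_def I'[symmetric] using red by blast
    moreover have "pot F D = card (F `` {y}) + pot F (D - {y})"
      by (rule pot_remove[OF rep_graph(5)[OF rep]]) simp
    ultimately have post: "\<exists>D'\<subseteq>D. rep F D' (doms F D' X) inp nb s' \<and> needed F D' X (Y - {y}) \<and>
       covered F D X \<subseteq> covered F D' X \<and>
       t + 160 * pot F D' \<le> 160 * pot F D + 20"
      if "rep F (D - {y}) (doms F (D - {y}) X) inp nb s'" "t \<le> 70 * card (F `` {y}) + 95" for t s'
      using that d by (intro exI[of _ "D - {y}"]) auto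
    show ?thesis
      unfolding CHECK_def using rep rows
      apply (simp add: wp_simps)
      apply (rule wp_call[OF wp_REMOVE[where y = y and I = ?I and D = D and F = F
              and inp = inp and nb = nb]])
          apply (use full in auto)[4]
      subgoal for t s'
        using post[where s' = s' and t = "t + 11"] by (simp add: I')
      done
  qed
qed

text \<open>One new arc can make at most one vertex of \<open>D\<close> redundant, the former sole
  dominator of \<open>w\<close>. Checking it at once restores \<open>needed\<close> with no
  exceptions before the next arc.\<close>

lemma wp_ADDSTEP:
  assumes rep: "rep F D (doms F D X) inp nb s" and [simp]: "regs s 10 = x" "regs s 11 = w"
    and [simp]: "x < n" "w < n" and "sym F"
    and X: "X \<subseteq> Id \<union> F" "Domain X \<subseteq> {x}" and x: "x \<notin> D" "(x, w) \<notin> X" "(x, w) \<in> Id \<union> F"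
    and need: "needed F D X {}"
  shows "wp W ADDSTEP (\<lambda>t s'. \<exists>D'\<subseteq>D. rep F D' (doms F D' (insert (x, w) X)) inp nb s' \<and>
     needed F D' (insert (x, w) X) {} \<and>
     covered F D X \<subseteq> covered F D' (insert (x, w) X) \<and>
     t + 160 * pot F D' \<le> 160 * pot F D + 90) s"
proof -
  let ?I = "doms F D X" and ?X = "insert (x, w) X"
  have I': "?I(w := insert x (?I w)) = doms F D ?X"
    by (auto simp: doms_def fun_eq_iff)
  have 1: "wp W ADDARC (\<lambda>t s'. rep F D (doms F D ?X) inp nb s' \<and>
    regs s' 12 < n \<and> (\<forall>y. ?I w = {y} \<longrightarrow> regs s' 12 = y) \<and> t \<le> 60) s"
    unfolding I'[symmetric]
    by (rule wp_ADDARC[OF rep]) (use x in \<open>auto simp: doms_def\<close>)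
  have need': "needed F D ?X {y}" if "\<forall>v. ?I w = {v} \<longrightarrow> y = v" for y
    unfolding needed_def
  proof
    \<comment> \<open>An exclusively dominated vertex of any other \<open>u\<close> differs from
      \<open>w\<close>, so it keeps its single dominator.\<close>
    fix u assume u: "u \<in> D - {y}"
    with need obtain v where v: "v < n" "?I v = {u}" unfolding needed_def by blast
    with that u have "v \<noteq> w" by auto
    with v show "\<exists>v<n. doms F D ?X v = {u}"
      unfolding I'[symmetric] by (intro exI[of _ v]) auto
  qed
  have mono: "covered F D X \<subseteq> covered F D ?X"
    unfolding covered_def I'[symmetric] by auto
  show ?thesis
    unfolding ADDSTEP_def wp_Seq
  proof (rule wp_call[OF 1])
    fix t1 :: nat and s1
    assume s1: "rep F D (doms F D ?X) inp nb s1 \<and> regs s1 12 < n \<and>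
      (\<forall>y. ?I w = {y} \<longrightarrow> regs s1 12 = y) \<and> t1 \<le> 60"
    define y where "y = regs s1 12"
    have [simp]: "y < n" using s1 y_def by simp
    have 2: "wp W CHECK (\<lambda>t s'. \<exists>D'\<subseteq>D. rep F D' (doms F D' ?X) inp nb s' \<and>
        needed F D' ?X ({y} - {y}) \<and>
        covered F D ?X \<subseteq> covered F D' ?X \<and>
        t + 160 * pot F D' \<le> 160 * pot F D + 20) (set_reg 16 y (set_reg 5 0 s1))"
      by (rule wp_CHECK) (use s1 X x \<open>sym F\<close> in \<open>auto simp: y_def intro!: need'\<close>)
    show "wp W (MOV 16 12) (\<lambda>t s1. wp W CHECK (\<lambda>t' s'. \<exists>D'\<subseteq>D. rep F D' (doms F D' ?X) inp nb s' \<and>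
        needed F D' ?X {} \<and> covered F D X \<subseteq> covered F D' ?X \<and>
        t1 + (t + t') + 160 * pot F D' \<le> 160 * pot F D + 90) s1) s1"
      unfolding wp_MOV[of 12 16, simplified]
    proof (intro conjI wp_call[OF 2[unfolded y_def]])
      show "regs s1 12 < W" using s1 by simp
    next
      fix t' :: nat and s'
      assume "\<exists>D'\<subseteq>D. rep F D' (doms F D' ?X) inp nb s' \<and>
        needed F D' ?X ({regs s1 12} - {regs s1 12}) \<and>
        covered F D ?X \<subseteq> covered F D' ?X \<and>
        t' + 160 * pot F D' \<le> 160 * pot F D + 20"
      then obtain D' where D': "D' \<subseteq> D" "rep F D' (doms F D' ?X) inp nb s'" "needed F D' ?X {}"
        "covered F D ?X \<subseteq> covered F D' ?X"
        "t' + 160 * pot F D' \<le> 160 * pot F D + 20"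
        by auto
      then show "\<exists>D'\<subseteq>D. rep F D' (doms F D' ?X) inp nb s' \<and>
        needed F D' ?X {} \<and> covered F D X \<subseteq> covered F D' ?X \<and>
        t1 + (2 + t') + 160 * pot F D' \<le> 160 * pot F D + 90"
        using s1 mono by (intro exI[of _ D']) auto
    qed
  qed
qed

text \<open>\<open>x\<close> is itself needed in the end: \<open>z\<close> had no dominator, and the
  vertices removed on the way only shrink the old set, so \<open>x\<close> alone dominates
  \<open>z\<close>. The factor 270 consists of 110 for each loop round and 160 for the potential of
  \<open>x\<close>.\<close>

lemma wp_ADD:
  assumes rep: "rep F D (doms F D {}) inp nb s" and [simp]: "regs s 10 = x" "x < n" and "sym F"
    and z: "z < n" "doms F D {} z = {}" "x = z \<or> (x, z) \<in> F" and need: "needed F D {} {}"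
  shows "wp W ADD (\<lambda>t s'. \<exists>D'. rep F D' (doms F D' {}) inp nb s' \<and> needed F D' {} {} \<and>
     covered F D {} \<subseteq> covered F D' {} \<and> z \<in> covered F D' {} \<and>
     t + 160 * pot F D' \<le> 160 * pot F D + 270 * card (F `` {x}) + 120) s"
proof -
  define d where "d = card (F `` {x})"
  define X where "X i = {x} \<times> seen nb x i" for i
  have XS: "X (Suc i) = insert (x, nb (x * n + i)) (X i)" for i
    by (auto simp: X_def seen_Suc)
  have X0: "X 0 = {(x, x)}" by (auto simp: X_def seen_0)
  have Xd: "X d = {x} \<times> insert x (F `` {x})"
    using seen_all[OF rep, of x] by (simp add: X_def d_def)
  have X: "X i \<subseteq> Id \<union> F" if "i \<le> d" for i
    using seen_sub[OF rep, of x i] that by (auto simp: X_def d_def)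
  have x: "x \<notin> D" using z(2,3) by (auto simp: doms_def)
  \<comment> \<open>The state after \<open>i\<close> rounds and total time \<open>K\<close>: 90 for
    the initial step at \<open>x\<close> itself, and for each round 90 for its step plus list access
    and loop overhead.\<close>
  define Q where "Q i D' K s' \<longleftrightarrow> D' \<subseteq> D \<and> rep F D' (doms F D' (X i)) inp nb s' \<and>
      needed F D' (X i) {} \<and> covered F D {} \<subseteq> covered F D' (X i) \<and>
      K + 160 * pot F D' \<le> 160 * pot F D + 110 * i + 90" for i D' K s'
  \<comment> \<open>The subtraction of 1 takes out the final failing test, which the invariant does
    not count.\<close>
  have loop: "wp W (While (Less 18 19) ADD_BODY) (\<lambda>t s'. (\<exists>D'. Q d D' (t0 + t - 1) s') \<and> regs s' 10 = x) s1"
    if "Q 0 D1 t0 s1" "regs s1 10 = x" "regs s1 18 = 0" "regs s1 19 = d" for s1 t0 D1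
  proof (rule wp_While[where J = "\<lambda>t s'. \<exists>i\<le>d. regs s' 18 = i \<and> regs s' 19 = d \<and> regs s' 10 = x
        \<and> (\<exists>D'. Q i D' (t0 + t) s')" and \<mu> = "\<lambda>s'. d - regs s' 18"], goal_cases)
    case 1
    show ?case using that by auto
  next
    case (2 t s2)
    then obtain i D2 where i: "i < d" and [simp]: "regs s2 18 = i" "regs s2 19 = d" "regs s2 10 = x"
      and Q: "Q i D2 (t0 + t) s2"
      by auto
    then have r: "rep F D2 (doms F D2 (X i)) inp nb s2" by (simp add: Q_def)
    note nb = rep_nb[OF r \<open>x < n\<close> i[unfolded d_def]]
    have [simp]: "i < n" "nb (x * n + i) < n" using nb by auto
    have [simp]: "regs s2 3 = n" "regs s2 4 = n * n" "arr n s2 5 = nb"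
      using rep_regs[OF r] rep_rows(2)[OF r \<open>x < n\<close>] by auto
    let ?w = "nb (x * n + i)"
    let ?s = "set_reg 11 ?w (set_reg 5 (5 * (n * n) + (x * n + i))
      (set_reg 11 (x * n + i) (set_reg 5 (x * n) s2)))"
    have step: "wp W ADDSTEP (\<lambda>t s'. \<exists>D'\<subseteq>D2. rep F D' (doms F D' (insert (x, ?w) (X i))) inp nb s' \<and>
       needed F D' (insert (x, ?w) (X i)) {} \<and>
       covered F D2 (X i) \<subseteq> covered F D' (insert (x, ?w) (X i)) \<and>
       t + 160 * pot F D' \<le> 160 * pot F D2 + 90) ?s"
      by (rule wp_ADDSTEP)
        (use r Q nb X[of i] i x seen_fresh[OF r, of x i] \<open>sym F\<close> in \<open>auto simp: Q_def X_def d_def\<close>)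
    show ?case
      unfolding ADD_BODY_def
      apply (simp add: wp_simps)
      apply (rule wp_call[OF step])
      apply (elim exE conjE)
      subgoal for t' s' D'
        using Q i by (auto simp: wp_simps Q_def XS intro!: exI[of _ D'])
      done
  next
    case (3 t s2)
    then show ?case by auto
  qed
  have [simp]: "regs s 3 = n" "regs s 4 = n * n" using rep_regs[OF rep] by auto
  have first: "wp W ADDSTEP (\<lambda>t s'. \<exists>D'\<subseteq>D. rep F D' (doms F D' {(x, x)}) inp nb s' \<and>
       needed F D' {(x, x)} {} \<and>
       covered F D {} \<subseteq> covered F D' {(x, x)} \<and>
       t + 160 * pot F D' \<le> 160 * pot F D + 90) (set_reg 11 x (set_reg 5 0 s))"
    by (rule wp_ADDSTEP) (use rep x need \<open>sym F\<close> in auto)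
  have last: "\<exists>D'. rep F D' (doms F D' {}) inp nb (upd_arr n 0 x (Suc 0) s') \<and> needed F D' {} {} \<and>
     covered F D {} \<subseteq> covered F D' {} \<and> z \<in> covered F D' {} \<and>
     t + 160 * pot F D' \<le> 160 * pot F D + 270 * d + 120"
    if "Q d D2 K s'" "t \<le> K + 30" for D2 K s' t
  proof -
    from that have D2: "D2 \<subseteq> D" and r: "rep F D2 (doms F D2 (X d)) inp nb s'"
      and need: "needed F D2 (X d) {}"
      and cover: "covered F D {} \<subseteq> covered F D2 (X d)"
      and K: "K + 160 * pot F D2 \<le> 160 * pot F D + 110 * d + 90"
      by (auto simp: Q_def)
    \<comment> \<open>Once all arcs of \<open>x\<close> are present, setting its membership bit
      changes no set of dominators; the bit alone is missing.\<close>
    have eq: "doms F D2 (X d) = doms F (insert x D2) {}"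
      unfolding Xd by (auto simp: doms_def fun_eq_iff)
    have "doms F D2 {} z = {}" using z(2) D2 by (auto simp: doms_def)
    then have dz: "doms F (insert x D2) {} z = {x}" using z(3) by (auto simp: doms_def)
    have "pot F (insert x D2) = d + pot F D2"
      unfolding d_def by (rule pot_insert[OF rep_graph(5)[OF r]]) (use x D2 in auto)
    moreover have "needed F (insert x D2) {} {}"
      using need dz z(1) unfolding needed_def eq by auto
    moreover have "z \<in> covered F (insert x D2) {}" "covered F D2 (X d) = covered F (insert x D2) {}"
      using z(1) dz by (auto simp: covered_def eq)
    ultimately show ?thesis
      using rep_insert[OF r, of x] cover K that(2) unfolding eq
      by (intro exI[of _ "insert x D2"]) auto
  qed
  show ?thesis
    unfolding ADD_def
    apply (simp add: wp_simps)
    apply (rule wp_call[OF first])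
    apply (elim exE conjE)
    subgoal for t1 s1 D1
      using rep_regs[of F D1 "doms F D1 {(x, x)}" inp nb s1] rep_rows(1)[of F D1 "doms F D1 {(x, x)}" inp nb s1 x]
      apply (simp add: wp_simps)
      apply (rule wp_call[OF loop[where ?t0.0 = t1 and ?D1.0 = D1]])
          apply (simp add: Q_def X0)
         apply simp
        apply simp
       apply (simp add: d_def)
      apply (elim exE conjE)
      subgoal for t2 s2 D2
        using rep_regs[of F D2 "doms F D2 (X d)" inp nb s2]
          last[of D2 "t1 + t2 - 1" "set_reg 5 x (set_reg 6 (Suc 0) s2)" "t1 + t2 + 12"]
        by (simp add: wp_simps Q_def[of d D2] d_def[symmetric] add.assoc)
      done
    done
qed

end

section \<open>Edge insertions and deletions\<close>

definition LINK :: com where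
  "LINK = Seq ADDADJ (Seq (MOV 12 11) (Seq (LD 6 0 10) (Seq (Const 7 1)
    (Cond (Equal 6 7) ADDARC Skip))))"

definition UNLINK :: com where
  "UNLINK = Seq DELADJ (Seq (LD 6 0 16) (Seq (Const 7 1) (Cond (Equal 6 7) DELARC Skip)))"

definition INSERT :: com where
  "INSERT = Seq (MOV 10 1) (Seq (MOV 11 2) (Seq LINK
    (Seq (MOV 21 12) (Seq (MOV 10 2) (Seq (MOV 11 1) (Seq LINK
    (Seq (MOV 16 21) (Seq CHECK (Seq (MOV 16 12) CHECK)))))))))"

definition DELETE :: com where
  "DELETE = Seq (MOV 16 1) (Seq (MOV 17 2) (Seq UNLINK (Seq (MOV 16 2) (Seq (MOV 17 1)
    (Seq UNLINK (Seq (MOV 16 1) (Seq CHECK (Seq (MOV 16 2) (Seq CHECK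
    (Seq (MOV 20 1) (Seq DOMINATE (Seq (MOV 20 2) DOMINATE))))))))))))"

lemma writes_LINK [simp]: "writes LINK = {5, 6, 7, 8, 12}"
  by (auto simp: LINK_def)
lemma writes_UNLINK [simp]: "writes UNLINK = {5, 6, 7, 8, 9}"
  by (auto simp: UNLINK_def)
lemma writes_INSERT [simp]: "writes INSERT = {5, 6, 7, 8, 10, 11, 12, 14, 15, 16, 17, 21}"
  by (auto simp: INSERT_def)
lemma writes_DELETE [simp]:
  "writes DELETE = {5, 6, 7, 8, 9, 10, 11, 12, 14, 15, 16, 17, 18, 19, 20}"
  by (auto simp: DELETE_def)

context word_ram
begin

section \<open>Finding a cheap dominator for an uncovered vertex\<close>

lemma card_arcs:
  assumes "F \<subseteq> {..<n} \<times> {..<n}"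
  shows "card F = (\<Sum>v<n. card (F `` {v}))"
proof -
  have "F = (SIGMA v:{..<n}. F `` {v})" using assms by auto
  moreover have "finite (F `` {v})" for v
    using assms by (auto intro: finite_subset[of _ "{..<n}"])
  ultimately show ?thesis by (metis card_SigmaI finite_lessThan)
qed

text \<open>The \<open>i\<close> distinct vertices have degrees at least
  \<open>1, 2, \<dots>, i\<close>, and all degrees together make up \<open>card F\<close>. For a
  symmetric \<open>F\<close> the right-hand side is four times the number of edges.\<close>

lemma scan_bound:
  assumes F: "F \<subseteq> {..<n} \<times> {..<n}" and inj: "inj_on f {..<i}" and f: "f ` {..<i} \<subseteq> {..<n}"
    and deg: "\<And>j. j < i \<Longrightarrow> j < card (F `` {f j})"
  shows "i * (i + 1) \<le> 2 * card F"
proof -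
  have "i * (i + 1) = 2 * (\<Sum>j<i. j + 1)"
    by (induction i) auto
  also have "\<dots> \<le> 2 * (\<Sum>j<i. card (F `` {f j}))"
    by (intro mult_left_mono sum_mono) (use deg in fastforce)+
  also have "(\<Sum>j<i. card (F `` {f j})) = (\<Sum>v\<in>f ` {..<i}. card (F `` {v}))"
    using inj by (simp add: sum.reindex)
  also have "\<dots> \<le> (\<Sum>v<n. card (F `` {v}))"
    by (rule sum_mono2) (use f in auto)
  finally show ?thesis using card_arcs[OF F] by simp
qed

lemma wp_FIND:
  assumes rep: "rep F D I inp nb s" and [simp]: "regs s 20 = z" "z < n"
  shows "wp W FIND (\<lambda>t s'. rep F D I inp nb s' \<and> (regs s' 10 = z \<or> (z, regs s' 10) \<in> F) \<and>
    (\<exists>i. card (F `` {regs s' 10}) \<le> i \<and> i * (i + 1) \<le> 2 * card F \<and> t \<le> 20 * i + 40)) s"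
proof -
  define d where "d = card (F `` {z})"
  define f where "f i = nb (z * n + i)" for i
  have bound: "i * (i + 1) \<le> 2 * card F" if "i \<le> d" "\<forall>j<i. j < card (F `` {f j})" for i
  proof (rule scan_bound[OF rep_graph(1)[OF rep]])
    have "bij_betw f {..<d} (F `` {z})" using rep_bij[OF rep, of z] by (simp add: f_def[abs_def] d_def)
    then show "inj_on f {..<i}" using that(1) by (auto simp: bij_betw_def inj_on_def)
    show "f ` {..<i} \<subseteq> {..<n}" using that(1) rep_nb(2)[OF rep, of z] by (auto simp: f_def d_def)
  qed (use that in auto)
  have loop: "wp W (While (Less 18 19) FIND_BODY)
      (\<lambda>t s'. rep F D I inp nb s' \<and> (regs s' 10 = z \<or> (z, regs s' 10) \<in> F) \<and>
        (\<exists>i. card (F `` {regs s' 10}) \<le> i \<and> i * (i + 1) \<le> 2 * card F \<and> t \<le> 20 * i + 30)) s1"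
    if "rep F D I inp nb s1" "regs s1 18 = 0" "regs s1 19 = d" "regs s1 10 = z" "regs s1 20 = z" for s1
  \<comment> \<open>The search is aborted by setting register 19 to 0, which makes the loop test
    fail; the second disjunct describes that state. The successful round does not advance
    \<open>i\<close>, hence its separate allowance of 20. If no round succeeds, \<open>i\<close>
    ends at the degree of \<open>z\<close>, and \<open>z\<close> itself is the answer.\<close>
  proof (rule wp_While[where J = "\<lambda>t s'. rep F D I inp nb s' \<and> regs s' 20 = z \<and>
        (\<exists>i\<le>d. regs s' 18 = i \<and> (\<forall>j<i. j < card (F `` {f j})) \<and>
         (regs s' 19 = d \<and> regs s' 10 = z \<and> t \<le> 20 * i \<or>
          regs s' 19 = 0 \<and> (z, regs s' 10) \<in> F \<and> card (F `` {regs s' 10}) \<le> i \<and> t \<le> 20 * i + 20))"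
        and \<mu> = "\<lambda>s'. regs s' 19 - regs s' 18"], goal_cases)
    case 1
    show ?case using that by auto
  next
    case (2 t s2)
    then have r: "rep F D I inp nb s2" by simp
    from 2 obtain i where i: "i < d" and [simp]: "regs s2 18 = i" "regs s2 19 = d" "regs s2 10 = z"
      "regs s2 20 = z" and before: "\<forall>j<i. j < card (F `` {f j})" and t: "t \<le> 20 * i"
      by auto
    note nb = rep_nb[OF r \<open>z < n\<close> i[unfolded d_def]]
    have [simp]: "i < n" "nb (z * n + i) < n" using nb by auto
    have [simp]: "regs s2 3 = n" "regs s2 4 = n * n" "arr n s2 5 = nb"
      using rep_regs[OF r] rep_rows(2)[OF r \<open>z < n\<close>] by auto
    have [simp]: "arr n s2 (Suc 0) (nb (z * n + i)) = card (F `` {nb (z * n + i)})"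
      by (rule rep_rows(1)[OF r]) simp
    show ?case
    proof (cases "i < card (F `` {nb (z * n + i)})")
      case True
      with before have "\<forall>j<Suc i. j < card (F `` {f j})"
        by (auto simp: f_def less_Suc_eq)
      with True show ?thesis
        unfolding FIND_BODY_def using r t i by (simp add: wp_simps)
    next
      case False
      with before show ?thesis
        unfolding FIND_BODY_def using r t i nb(1) by (simp add: wp_simps)
    qed
  next
    case (3 t s2)
    then obtain i where "i \<le> d" "\<forall>j<i. j < card (F `` {f j})"
      and "regs s2 19 = d \<and> regs s2 10 = z \<and> t \<le> 20 * i \<and> i = d \<or>
          (z, regs s2 10) \<in> F \<and> card (F `` {regs s2 10}) \<le> i \<and> t \<le> 20 * i + 20"
      by fastforce
    with bound[of i] 3 show ?case
      by (auto simp: d_def intro!: exI[of _ i])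
  qed
  have [simp]: "regs s 3 = n" "regs s 4 = n * n" "arr n s (Suc 0) z = d"
    using rep_regs[OF rep] rep_rows(1)[OF rep] by (auto simp: d_def)
  show ?thesis
    unfolding FIND_def
    apply (simp add: wp_simps)
    apply (rule wp_call[OF loop])
         apply (use rep in \<open>simp_all\<close>)
    apply (elim conjE exE)
    subgoal for t' s' i by (intro exI[of _ i]) simp
    done
qed

text \<open>Both the scan length and the degree of the chosen vertex are at most \<open>q\<close>,
  so scanning (20 per neighbour) and adding (270 per neighbour) stay within \<open>300 * q\<close>
  up to a constant.\<close>

lemma wp_DOMINATE:
  assumes rep: "rep F D (doms F D {}) inp nb s" and [simp]: "regs s 20 = z" "z < n" and "sym F"
    and need: "needed F D {} {}" and q: "\<And>i. i * (i + 1) \<le> 2 * card F \<Longrightarrow> i \<le> q"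
  shows "wp W DOMINATE (\<lambda>t s'. \<exists>D'. rep F D' (doms F D' {}) inp nb s' \<and> needed F D' {} {} \<and>
     covered F D {} \<subseteq> covered F D' {} \<and> z \<in> covered F D' {} \<and>
     t + 160 * pot F D' \<le> 160 * pot F D + 300 * q + 200) s"
proof -
  have [simp]: "regs s 3 = n" "regs s 4 = n * n" using rep_regs[OF rep] by auto
  note rows = rep_rows[OF rep \<open>z < n\<close>]
  show ?thesis
  proof (cases "doms F D {} z = {}")
    case False
    then have "z \<in> covered F D {}" by (simp add: covered_def)
    with False rows rep need show ?thesis
      unfolding DOMINATE_def by (auto simp: wp_simps intro!: exI[of _ D])
  next
    case True
    let ?s = "set_reg 7 0 (set_reg 6 0 (set_reg 5 (2 * (n * n) + z) s))"
    have "wp W FIND (\<lambda>t s'. rep F D (doms F D {}) inp nb s' \<and> (regs s' 10 = z \<or> (z, regs s' 10) \<in> F) \<and>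
      (\<exists>i. card (F `` {regs s' 10}) \<le> i \<and> i * (i + 1) \<le> 2 * card F \<and> t \<le> 20 * i + 40)) ?s"
      by (rule wp_FIND) (use rep in auto)
    then obtain t1 s1 i where 1: "exec W FIND ?s t1 s1" "rep F D (doms F D {}) inp nb s1"
      "regs s1 10 = z \<or> (z, regs s1 10) \<in> F" "card (F `` {regs s1 10}) \<le> i"
      "i * (i + 1) \<le> 2 * card F" "t1 \<le> 20 * i + 40"
      unfolding wp_def by blast
    from q[OF 1(5)] have "i \<le> q" .
    define x where "x = regs s1 10"
    consider "x = z" | "(z, x) \<in> F" using 1(3) x_def by auto
    then have "x < n \<and> (x = z \<or> (x, z) \<in> F)"
      by cases (use rep_graph(1)[OF rep] \<open>sym F\<close> in \<open>auto dest: symD\<close>)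
    then have "wp W ADD (\<lambda>t s'. \<exists>D'. rep F D' (doms F D' {}) inp nb s' \<and> needed F D' {} {} \<and>
       covered F D {} \<subseteq> covered F D' {} \<and> z \<in> covered F D' {} \<and>
       t + 160 * pot F D' \<le> 160 * pot F D + 270 * card (F `` {x}) + 120) s1"
      by (intro wp_ADD) (use 1 need True \<open>sym F\<close> in \<open>auto simp: x_def\<close>)
    then obtain t2 s2 D' where 2: "exec W ADD s1 t2 s2" "rep F D' (doms F D' {}) inp nb s2"
      "needed F D' {} {}" "covered F D {} \<subseteq> covered F D' {}" "z \<in> covered F D' {}"
      "t2 + 160 * pot F D' \<le> 160 * pot F D + 270 * card (F `` {x}) + 120"
      unfolding wp_def by blast
    have both: "wp W (Seq FIND ADD) (\<lambda>t s'. t = t1 + t2 \<and> s' = s2) ?s"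
      unfolding wp_def using exec.Seq[OF 1(1) 2(1)] by blast
    show ?thesis
      unfolding DOMINATE_def using rows True 1 2 \<open>i \<le> q\<close> x_def[symmetric]
      apply (simp add: wp_Seq[where a = "LD _ _ _"] wp_Seq[where a = "Const _ _"] wp_Const wp_Cond
          wp_LD)
      apply (rule wp_call[OF both])
      apply (intro exI[of _ D'])
      apply simp
      done
  qed
qed

text \<open>Determinism turns a known execution into a rewrite rule, so that long sequences of calls
  can be composed by simplification.\<close>

lemma wp_eq: "exec W c s t s' \<Longrightarrow> wp W c P s \<longleftrightarrow> P t s'"
  unfolding wp_def using exec_deterministic by blast

text \<open>The dominators change only at \<open>w\<close>, and only if \<open>x \<in> D\<close>.
  The sole vertex that can lose its justification is the former unique dominator of
  \<open>w\<close>, handed over in register 12 for a later check.\<close>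

lemma wp_LINK:
  assumes rep: "rep F D (doms F D {}) inp nb s" and x [simp]: "regs s 10 = x" "regs s 11 = w"
    and [simp]: "x < n" "w < n" "x \<noteq> w" and new: "(x, w) \<notin> F" and need: "needed F D {} Y"
  defines "F' \<equiv> insert (x, w) F"
  shows "wp W LINK (\<lambda>t s'. (\<exists>nb'. rep F' D (doms F' D {}) inp nb' s') \<and> regs s' 12 < n \<and>
    needed F' D {} (insert (regs s' 12) Y) \<and> covered F D {} \<subseteq> covered F' D {} \<and> t \<le> 110) s"
proof -
  let ?I = "doms F D {}"
  have 1: "wp W ADDADJ (\<lambda>t s'. (\<exists>nb'. rep F' D ?I inp nb' s') \<and> t \<le> 30) s"
    unfolding F'_def by (rule wp_ADDADJ) (use rep new in auto)
  have F': "doms F' D {} = (if x \<in> D then ?I(w := insert x (?I w)) else ?I)"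
    by (auto simp: F'_def doms_def fun_eq_iff)
  have cover: "covered F D {} \<subseteq> covered F' D {}"
    unfolding covered_def F' by auto
  have need': "needed F' D {} (insert y Y)" if "x \<in> D \<longrightarrow> (\<forall>v. ?I w = {v} \<longrightarrow> y = v)" for y
    unfolding needed_def
  proof
    fix u assume u: "u \<in> D - insert y Y"
    with need obtain v where v: "v < n" "?I v = {u}" unfolding needed_def by blast
    with that u have "x \<in> D \<longrightarrow> v \<noteq> w" by auto
    with v show "\<exists>v<n. doms F' D {} v = {u}"
      unfolding F' by (intro exI[of _ v]) auto
  qed
  show ?thesis
    unfolding LINK_def wp_Seq[where a = ADDADJ]
  proof (rule wp_call[OF 1])
    fix t1 :: nat and s1
    assume "(\<exists>nb'. rep F' D ?I inp nb' s1) \<and> t1 \<le> 30"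
      and frame: "\<And>q. q \<notin> writes ADDADJ \<Longrightarrow> regs s1 q = regs s q"
    then obtain nb' where r: "rep F' D ?I inp nb' s1" and t1: "t1 \<le> 30" by blast
    have [simp]: "regs s1 10 = x" "regs s1 11 = w" using frame by auto
    have [simp]: "regs s1 3 = n" "regs s1 4 = n * n" "arr n s1 0 x = of_bool (x \<in> D)"
      using rep_regs[OF r] rep_rows(3)[OF r] by auto
    let ?s = "set_reg 7 (Suc 0) (set_reg 6 (of_bool (x \<in> D)) (set_reg 5 x
      (set_reg 12 w (set_reg 5 0 s1))))"
    show "wp W (Seq (MOV 12 11) (Seq (LD 6 0 10) (Seq (Const 7 1) (Cond (Equal 6 7) ADDARC Skip))))
        (\<lambda>t' s'. (\<exists>nb'. rep F' D (doms F' D {}) inp nb' s') \<and> regs s' 12 < n \<and>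
          needed F' D {} (insert (regs s' 12) Y) \<and> covered F D {} \<subseteq> covered F' D {} \<and> t1 + t' \<le> 110) s1"
    proof (cases "x \<in> D")
      case False
      then show ?thesis
        using r need'[of w] cover t1 by (auto simp: wp_simps F')
    next
      case True
      have 2: "wp W ADDARC (\<lambda>t s'. rep F' D (doms F' D {}) inp nb' s' \<and>
        regs s' 12 < n \<and> (\<forall>y. ?I w = {y} \<longrightarrow> regs s' 12 = y) \<and> t \<le> 60) ?s"
        unfolding F' if_P[OF True]
        by (rule wp_ADDARC) (use r new in \<open>auto simp: doms_def\<close>)
      show ?thesis
        using True
        apply (simp add: wp_simps)
        apply (rule wp_call[OF 2[simplified True of_bool_eq One_nat_def]])
        using cover need' t1 by auto
    qed
  qed
qed

text \<open>Only the dominator \<open>x\<close> can disappear, and only from \<open>w\<close>. So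
  only \<open>x\<close> may become redundant and only \<open>w\<close> may become uncovered.\<close>

lemma wp_UNLINK:
  assumes rep: "rep F D (doms F D {}) inp nb s" and x [simp]: "regs s 16 = x" "regs s 17 = w"
    and xw: "(x, w) \<in> F" and need: "needed F D {} Y"
  defines "F' \<equiv> F - {(x, w)}"
  shows "wp W UNLINK (\<lambda>t s'. (\<exists>nb'. rep F' D (doms F' D {}) inp nb' s') \<and>
    needed F' D {} (insert x Y) \<and> covered F D {} - {w} \<subseteq> covered F' D {} \<and> t \<le> 110) s"
proof -
  let ?I = "doms F D {}"
  have [simp]: "x < n" "w < n" using xw rep_graph(1)[OF rep] by auto
  have "x \<noteq> w" using xw rep_graph(3)[OF rep] by (auto simp: irrefl_def)
  have 1: "wp W DELADJ (\<lambda>t s'. (\<exists>nb'. rep F' D ?I inp nb' s') \<and> t \<le> 40) s"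
    unfolding F'_def by (rule wp_DELADJ) (use rep xw in auto)
  have F': "doms F' D {} = (if x \<in> D then ?I(w := ?I w - {x}) else ?I)"
    using \<open>x \<noteq> w\<close> by (auto simp: F'_def doms_def fun_eq_iff)
  have cover: "covered F D {} - {w} \<subseteq> covered F' D {}"
    unfolding covered_def F' by auto
  have need': "needed F' D {} (insert x Y)"
    unfolding needed_def
  proof
    fix u assume u: "u \<in> D - insert x Y"
    with need obtain v where v: "v < n" "?I v = {u}" unfolding needed_def by blast
    with u show "\<exists>v<n. doms F' D {} v = {u}"
      unfolding F' by (intro exI[of _ v]) auto
  qed
  show ?thesis
    unfolding UNLINK_def wp_Seq[where a = DELADJ]
  proof (rule wp_call[OF 1])
    fix t1 :: nat and s1
    assume "(\<exists>nb'. rep F' D ?I inp nb' s1) \<and> t1 \<le> 40"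
      and frame: "\<And>q. q \<notin> writes DELADJ \<Longrightarrow> regs s1 q = regs s q"
    then obtain nb' where r: "rep F' D ?I inp nb' s1" and t1: "t1 \<le> 40" by blast
    have [simp]: "regs s1 16 = x" "regs s1 17 = w" using frame by auto
    have [simp]: "regs s1 3 = n" "regs s1 4 = n * n" "arr n s1 0 x = of_bool (x \<in> D)"
      using rep_regs[OF r] rep_rows(3)[OF r] by auto
    let ?s = "set_reg 7 (Suc 0) (set_reg 6 (Suc 0) (set_reg 5 x s1))"
    show "wp W (Seq (LD 6 0 16) (Seq (Const 7 1) (Cond (Equal 6 7) DELARC Skip)))
        (\<lambda>t' s'. (\<exists>nb'. rep F' D (doms F' D {}) inp nb' s') \<and>
          needed F' D {} (insert x Y) \<and> covered F D {} - {w} \<subseteq> covered F' D {} \<and> t1 + t' \<le> 110) s1"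
    proof (cases "x \<in> D")
      case False
      then show ?thesis
        using r need' cover t1 by (auto simp: wp_simps F')
    next
      case True
      have 2: "wp W DELARC (\<lambda>t s'. rep F' D (doms F' D {}) inp nb' s' \<and> t \<le> 50) ?s"
        unfolding F' if_P[OF True]
        by (rule wp_DELARC) (use r xw True in \<open>auto simp: doms_def\<close>)
      show ?thesis
        using True
        apply (simp add: wp_simps)
        apply (rule wp_call[OF 2])
        using cover need' t1 by auto
    qed
  qed
qed

section \<open>Amortised cost of an edge insertion and of an edge deletion\<close>

lemma pot_insert_arc:
  assumes "finite D"
  shows "pot (insert (x, w) F) D \<le> pot F D + 1"
proof -
  have "card (insert (x, w) F `` {v}) \<le> card (F `` {v}) + of_bool (v = x)" for v
  proof (cases "v = x")
    case True
    then have "insert (x, w) F `` {v} = insert w (F `` {v})" by auto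
    with True show ?thesis by (simp add: card_insert_le_m1 card_insert_if)
  next
    case False
    then have "insert (x, w) F `` {v} = F `` {v}" by auto
    with False show ?thesis by simp
  qed
  then have "pot (insert (x, w) F) D \<le> (\<Sum>v\<in>D. card (F `` {v}) + of_bool (v = x))"
    unfolding pot_def by (intro sum_mono)
  also have "\<dots> \<le> pot F D + 1"
    using assms card_mono[of "{x}" "D \<inter> {x}"] by (simp add: pot_def sum.distrib)
  finally show ?thesis .
qed

lemma pot_delete_arc: "finite F \<Longrightarrow> pot (F - {(x, w)}) D \<le> pot F D"
  unfolding pot_def by (intro sum_mono card_mono finite_Image) auto

definition valid :: "(nat \<times> nat) set \<Rightarrow> nat set \<Rightarrow> (nat \<Rightarrow> nat) \<Rightarrow> ram_state \<Rightarrow> bool" where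
  "valid F D inp s \<longleftrightarrow> (\<exists>nb. rep F D (doms F D {}) inp nb s) \<and> sym F \<and> needed F D {} {} \<and>
     covered F D {} = {..<n}"

lemma covered_subset: "covered F D X \<subseteq> {..<n}"
  by (auto simp: covered_def)

text \<open>Insertion uncovers nothing, so two checks suffice; they wait until both arcs are present
  because checking requires a symmetric \<open>F\<close>. Register 21 saves the first suspect from
  the second \<open>LINK\<close>. In the constant, 320 pays for the potential, which rises by at
  most 2.\<close>

lemma wp_INSERT:
  assumes valid: "valid F D inp s" and [simp]: "regs s 1 = u" "regs s 2 = v" "u < n" "v < n" "u \<noteq> v"
    and new: "(u, v) \<notin> F"
  defines "F' \<equiv> insert (v, u) (insert (u, v) F)"
  shows "wp W INSERT (\<lambda>t s'. \<exists>D'. valid F' D' inp s' \<and> t + 160 * pot F' D' \<le> 160 * pot F D + 620) s"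
proof -
  let ?F1 = "insert (u, v) F"
  have [simp]: "regs s (Suc 0) = u" using assms(2) by simp
  have [simp]: "v \<noteq> u" using \<open>u \<noteq> v\<close> by (rule not_sym)
  from valid obtain nb where r: "rep F D (doms F D {}) inp nb s" and "sym F"
    and need: "needed F D {} {}" and cov: "covered F D {} = {..<n}"
    unfolding valid_def by blast
  then have new': "(v, u) \<notin> ?F1" using new by (auto dest: symD)
  have "sym F'" using \<open>sym F\<close> by (auto simp: F'_def sym_def)
  let ?s = "set_reg 11 v (set_reg 5 0 (set_reg 10 u (set_reg 5 0 s)))"
  have "wp W LINK (\<lambda>t s'. (\<exists>nb'. rep ?F1 D (doms ?F1 D {}) inp nb' s') \<and> regs s' 12 < n \<and>
    needed ?F1 D {} (insert (regs s' 12) {}) \<and> covered F D {} \<subseteq> covered ?F1 D {} \<and> t \<le> 110) ?s"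
    by (rule wp_LINK) (use r new need in auto)
  then obtain t1 s1 nb1 y1 where e1: "exec W LINK ?s t1 s1"
    and r1: "rep ?F1 D (doms ?F1 D {}) inp nb1 s1" and [simp]: "regs s1 12 = y1" "y1 < n"
    and need1: "needed ?F1 D {} {y1}" and c1: "covered F D {} \<subseteq> covered ?F1 D {}" "t1 \<le> 110"
    unfolding wp_def by blast
  have [simp]: "regs s1 1 = u" "regs s1 (Suc 0) = u" "regs s1 2 = v" using exec_writes[OF e1] by auto
  let ?s1 = "set_reg 11 u (set_reg 5 0 (set_reg 10 v (set_reg 5 0 (set_reg 21 y1 (set_reg 5 0 s1)))))"
  have "wp W LINK (\<lambda>t s'. (\<exists>nb'. rep F' D (doms F' D {}) inp nb' s') \<and> regs s' 12 < n \<and>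
    needed F' D {} (insert (regs s' 12) {y1}) \<and> covered ?F1 D {} \<subseteq> covered F' D {} \<and> t \<le> 110) ?s1"
    unfolding F'_def by (rule wp_LINK) (use r1 new' need1 in auto)
  then obtain t2 s2 nb2 y2 where e3: "exec W LINK ?s1 t2 s2"
    and r2: "rep F' D (doms F' D {}) inp nb2 s2" and [simp]: "regs s2 12 = y2" "y2 < n"
    and need2: "needed F' D {} {y2, y1}" and c2: "covered ?F1 D {} \<subseteq> covered F' D {}" "t2 \<le> 110"
    unfolding wp_def by blast
  have [simp]: "regs s2 21 = y1" using exec_writes[OF e3] by auto
  let ?s2 = "set_reg 16 y1 (set_reg 5 0 s2)"
  have "wp W CHECK (\<lambda>t s'. \<exists>D'\<subseteq>D. rep F' D' (doms F' D' {}) inp nb2 s' \<and>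
     needed F' D' {} ({y2, y1} - {y1}) \<and> covered F' D {} \<subseteq> covered F' D' {} \<and>
     t + 160 * pot F' D' \<le> 160 * pot F' D + 20) ?s2"
    by (rule wp_CHECK) (use r2 \<open>sym F'\<close> need2 in auto)
  then obtain t3 s3 D3 where e5: "exec W CHECK ?s2 t3 s3" and r3: "rep F' D3 (doms F' D3 {}) inp nb2 s3"
    and need3: "needed F' D3 {} ({y2, y1} - {y1})" and c3: "covered F' D {} \<subseteq> covered F' D3 {}"
      "t3 + 160 * pot F' D3 \<le> 160 * pot F' D + 20"
    unfolding wp_def by blast
  have [simp]: "regs s3 12 = y2" using exec_writes[OF e5] by auto
  let ?s3 = "set_reg 16 y2 (set_reg 5 0 s3)"
  have "wp W CHECK (\<lambda>t s'. \<exists>D'\<subseteq>D3. rep F' D' (doms F' D' {}) inp nb2 s' \<and>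
     needed F' D' {} ({y2, y1} - {y1} - {y2}) \<and> covered F' D3 {} \<subseteq> covered F' D' {} \<and>
     t + 160 * pot F' D' \<le> 160 * pot F' D3 + 20) ?s3"
    by (rule wp_CHECK) (use r3 \<open>sym F'\<close> need3 in auto)
  then obtain t4 s4 D4 where e7: "exec W CHECK ?s3 t4 s4" and r4: "rep F' D4 (doms F' D4 {}) inp nb2 s4"
    and need4: "needed F' D4 {} ({y2, y1} - {y1} - {y2})" and c4: "covered F' D3 {} \<subseteq> covered F' D4 {}"
      "t4 + 160 * pot F' D4 \<le> 160 * pot F' D3 + 20"
    unfolding wp_def by blast
  have "needed F' D4 {} {}"
  proof -
    have "{y2, y1} - {y1} - {y2} = {}" by auto
    with need4 show ?thesis by simp
  qed
  moreover have "covered F' D4 {} = {..<n}"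
    using c1(1) c2(1) c3(1) c4(1) cov covered_subset[of F' D4 "{}"] by auto
  ultimately have "valid F' D4 inp s4"
    using r4 \<open>sym F'\<close> by (auto simp: valid_def)
  moreover have "finite D" by (rule rep_graph(5)[OF r])
  then have "pot F' D \<le> pot F D + 2"
    using pot_insert_arc[of D u v F] pot_insert_arc[of D v u ?F1] by (simp add: F'_def)
  ultimately show ?thesis
    unfolding INSERT_def using c1(2) c2(2) c3(2) c4(2)
    by (simp add: wp_Seq wp_MOV e1[THEN wp_eq] e3[THEN wp_eq] e5[THEN wp_eq] e7[THEN wp_eq])
      (intro exI[of _ D4], simp)
qed

text \<open>Only the two end points can become redundant or uncovered, and the potential does not
  rise by the deletion itself. The checks come first, since adding a dominator presupposes that
  every vertex of \<open>D\<close> is needed; the two calls of \<open>DOMINATE\<close> account for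
  \<open>600 * q\<close>.\<close>

lemma wp_DELETE:
  assumes valid: "valid F D inp s" and [simp]: "regs s 1 = u" "regs s 2 = v" and uv: "(u, v) \<in> F"
  defines "F' \<equiv> F - {(u, v)} - {(v, u)}"
  assumes q: "\<And>i. i * (i + 1) \<le> 2 * card F' \<Longrightarrow> i \<le> q"
  shows "wp W DELETE (\<lambda>t s'. \<exists>D'. valid F' D' inp s' \<and>
    t + 160 * pot F' D' \<le> 160 * pot F D + 600 * q + 700) s"
proof -
  let ?F1 = "F - {(u, v)}"
  from valid obtain nb where r: "rep F D (doms F D {}) inp nb s" and "sym F"
    and need: "needed F D {} {}" and cov: "covered F D {} = {..<n}"
    unfolding valid_def by blast
  have [simp]: "regs s (Suc 0) = u" "u < n" "v < n" "u \<noteq> v"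
    using rep_graph[OF r] uv assms(2) by (auto simp: irrefl_def)
  then have vu: "(v, u) \<in> ?F1" using uv \<open>sym F\<close> by (auto dest: symD)
  have "sym F'" using \<open>sym F\<close> by (auto simp: F'_def sym_def)
  let ?s = "set_reg 17 v (set_reg 5 0 (set_reg 16 u (set_reg 5 0 s)))"
  have "wp W UNLINK (\<lambda>t s'. (\<exists>nb'. rep ?F1 D (doms ?F1 D {}) inp nb' s') \<and>
    needed ?F1 D {} (insert u {}) \<and> covered F D {} - {v} \<subseteq> covered ?F1 D {} \<and> t \<le> 110) ?s"
    by (rule wp_UNLINK) (use r uv need in auto)
  then obtain t1 s1 nb1 where e1: "exec W UNLINK ?s t1 s1"
    and r1: "rep ?F1 D (doms ?F1 D {}) inp nb1 s1"
    and need1: "needed ?F1 D {} {u}" and c1: "covered F D {} - {v} \<subseteq> covered ?F1 D {}" "t1 \<le> 110"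
    unfolding wp_def by blast
  have [simp]: "regs s1 1 = u" "regs s1 (Suc 0) = u" "regs s1 2 = v" using exec_writes[OF e1] by auto
  let ?s1 = "set_reg 17 u (set_reg 5 0 (set_reg 16 v (set_reg 5 0 s1)))"
  have "wp W UNLINK (\<lambda>t s'. (\<exists>nb'. rep F' D (doms F' D {}) inp nb' s') \<and>
    needed F' D {} (insert v {u}) \<and> covered ?F1 D {} - {u} \<subseteq> covered F' D {} \<and> t \<le> 110) ?s1"
    unfolding F'_def by (rule wp_UNLINK) (use r1 vu need1 in auto)
  then obtain t2 s2 nb2 where e2: "exec W UNLINK ?s1 t2 s2"
    and r2: "rep F' D (doms F' D {}) inp nb2 s2"
    and need2: "needed F' D {} {v, u}" and c2: "covered ?F1 D {} - {u} \<subseteq> covered F' D {}" "t2 \<le> 110"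
    unfolding wp_def by blast
  have [simp]: "regs s2 1 = u" "regs s2 (Suc 0) = u" "regs s2 2 = v" using exec_writes[OF e2] by auto
  let ?s2 = "set_reg 16 u (set_reg 5 0 s2)"
  have "wp W CHECK (\<lambda>t s'. \<exists>D'\<subseteq>D. rep F' D' (doms F' D' {}) inp nb2 s' \<and>
     needed F' D' {} ({v, u} - {u}) \<and> covered F' D {} \<subseteq> covered F' D' {} \<and>
     t + 160 * pot F' D' \<le> 160 * pot F' D + 20) ?s2"
    by (rule wp_CHECK) (use r2 \<open>sym F'\<close> need2 in auto)
  then obtain t3 s3 D3 where e3: "exec W CHECK ?s2 t3 s3" and r3: "rep F' D3 (doms F' D3 {}) inp nb2 s3"
    and need3: "needed F' D3 {} ({v, u} - {u})" and c3: "covered F' D {} \<subseteq> covered F' D3 {}"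
      "t3 + 160 * pot F' D3 \<le> 160 * pot F' D + 20"
    unfolding wp_def by blast
  have [simp]: "regs s3 1 = u" "regs s3 (Suc 0) = u" "regs s3 2 = v" using exec_writes[OF e3] by auto
  let ?s3 = "set_reg 16 v (set_reg 5 0 s3)"
  have "wp W CHECK (\<lambda>t s'. \<exists>D'\<subseteq>D3. rep F' D' (doms F' D' {}) inp nb2 s' \<and>
     needed F' D' {} ({v, u} - {u} - {v}) \<and> covered F' D3 {} \<subseteq> covered F' D' {} \<and>
     t + 160 * pot F' D' \<le> 160 * pot F' D3 + 20) ?s3"
    by (rule wp_CHECK) (use r3 \<open>sym F'\<close> need3 in auto)
  then obtain t4 s4 D4 where e4: "exec W CHECK ?s3 t4 s4" and r4: "rep F' D4 (doms F' D4 {}) inp nb2 s4"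
    and need4: "needed F' D4 {} ({v, u} - {u} - {v})" and c4: "covered F' D3 {} \<subseteq> covered F' D4 {}"
      "t4 + 160 * pot F' D4 \<le> 160 * pot F' D3 + 20"
    unfolding wp_def by blast
  have [simp]: "regs s4 1 = u" "regs s4 (Suc 0) = u" "regs s4 2 = v" using exec_writes[OF e4] by auto
  have need4': "needed F' D4 {} {}"
  proof -
    have "{v, u} - {u} - {v} = {}" by auto
    with need4 show ?thesis by simp
  qed
  let ?s4 = "set_reg 20 u (set_reg 5 0 s4)"
  have "wp W DOMINATE (\<lambda>t s'. \<exists>D'. rep F' D' (doms F' D' {}) inp nb2 s' \<and> needed F' D' {} {} \<and>
     covered F' D4 {} \<subseteq> covered F' D' {} \<and> u \<in> covered F' D' {} \<and>
     t + 160 * pot F' D' \<le> 160 * pot F' D4 + 300 * q + 200) ?s4"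
    by (rule wp_DOMINATE) (use r4 \<open>sym F'\<close> need4' q in auto)
  then obtain t5 s5 D5 where e5: "exec W DOMINATE ?s4 t5 s5"
    and r5: "rep F' D5 (doms F' D5 {}) inp nb2 s5" and need5: "needed F' D5 {} {}"
    and c5: "covered F' D4 {} \<subseteq> covered F' D5 {}" "u \<in> covered F' D5 {}"
      "t5 + 160 * pot F' D5 \<le> 160 * pot F' D4 + 300 * q + 200"
    unfolding wp_def by blast
  have [simp]: "regs s5 2 = v" using exec_writes[OF e5] by auto
  let ?s5 = "set_reg 20 v (set_reg 5 0 s5)"
  have "wp W DOMINATE (\<lambda>t s'. \<exists>D'. rep F' D' (doms F' D' {}) inp nb2 s' \<and> needed F' D' {} {} \<and>
     covered F' D5 {} \<subseteq> covered F' D' {} \<and> v \<in> covered F' D' {} \<and>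
     t + 160 * pot F' D' \<le> 160 * pot F' D5 + 300 * q + 200) ?s5"
    by (rule wp_DOMINATE) (use r5 \<open>sym F'\<close> need5 q in auto)
  then obtain t6 s6 D6 where e6: "exec W DOMINATE ?s5 t6 s6"
    and r6: "rep F' D6 (doms F' D6 {}) inp nb2 s6" and need6: "needed F' D6 {} {}"
    and c6: "covered F' D5 {} \<subseteq> covered F' D6 {}" "v \<in> covered F' D6 {}"
      "t6 + 160 * pot F' D6 \<le> 160 * pot F' D5 + 300 * q + 200"
    unfolding wp_def by blast
  have "covered F' D6 {} = {..<n}"
    using c1(1) c2(1) c3(1) c4(1) c5(1,2) c6(1,2) cov covered_subset[of F' D6 "{}"] by blast
  then have "valid F' D6 inp s6"
    using r6 \<open>sym F'\<close> need6 by (auto simp: valid_def)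
  moreover have "finite F" by (rule rep_graph(2)[OF r])
  then have "pot F' D \<le> pot F D"
    using pot_delete_arc[of F u v D] pot_delete_arc[of ?F1 v u D] by (simp add: F'_def)
  ultimately show ?thesis
    unfolding DELETE_def using c1(2) c2(2) c3(2) c4(2) c5(3) c6(3)
    by (simp add: wp_Seq wp_MOV e1[THEN wp_eq] e2[THEN wp_eq] e3[THEN wp_eq] e4[THEN wp_eq]
        e5[THEN wp_eq] e6[THEN wp_eq])
      (intro exI[of _ D6], simp)
qed

end

section \<open>Updates and initialisation\<close>

definition UPDATE :: com where
  "UPDATE = Seq (Const 6 1) (Cond (Equal 0 6) INSERT DELETE)"

definition INIT_VERTEX :: com where
  "INIT_VERTEX = Seq (Const 6 1) (Seq (ST 0 25 6) (Seq (ST 2 25 6) (Seq (ST 3 25 25)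
    (Seq (ST 4 25 6) (INC 25)))))"

definition INIT_EDGE :: com where
  "INIT_EDGE = Seq (LD 1 0 27) (Seq (INC 27) (Seq (LD 2 0 27) (Seq (INC 27)
    (Seq INSERT (INC 25)))))"

text \<open>In the edgeless graph every vertex dominates exactly itself, so the full vertex set is
  the minimal dominating set. The start graph is then built by ordinary insertions, whose potential
  starts at zero.\<close>

definition INIT :: com where
  "INIT = Seq (Arith Mul 4 0 0) (Seq (MOV 3 0) (Seq (MOV 26 1) (Seq (MOV 27 0) (Seq (Const 25 0)
    (Seq (While (Less 25 3) INIT_VERTEX) (Seq (Const 25 0) (While (Less 25 26) INIT_EDGE)))))))"

section \<open>Undirected edges as pairs of opposite arcs\<close>

definition arcs :: "'a set set \<Rightarrow> ('a \<times> 'a) set" where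
  "arcs E = {(u, v). {u, v} \<in> E}"

lemma arcs_empty: "arcs {} = {}"
  by (simp add: arcs_def)

lemma arcs_insert: "arcs (insert {u, v} E) = insert (v, u) (insert (u, v) (arcs E))"
  by (auto simp: arcs_def doubleton_eq_iff)

lemma arcs_delete: "arcs (E - {{u, v}}) = arcs E - {(u, v)} - {(v, u)}"
  by (auto simp: arcs_def doubleton_eq_iff)

lemma arcs_subset:
  assumes "E \<subseteq> all_edges V"
  shows "arcs E \<subseteq> V \<times> V - Id"
  using assms by (fastforce simp: arcs_def all_edges_def doubleton_eq_iff)

lemma finite_all_edges: "finite V \<Longrightarrow> finite (all_edges V)"
  by (rule finite_subset[of _ "Pow V"]) (auto simp: all_edges_def)

lemma card_arcs_eq:
  assumes "finite V" "E \<subseteq> all_edges V"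
  shows "card (arcs E) = 2 * card E"
proof -
  have "finite E" using assms finite_all_edges finite_subset by blast
  then show ?thesis using assms(2)
  proof (induction E)
    case empty
    then show ?case by (simp add: arcs_empty)
  next
    case (insert e E)
    then obtain u v where e: "e = {u, v}" "u \<noteq> v" by (auto simp: all_edges_def)
    have "arcs E \<subseteq> V \<times> V" using arcs_subset[of E V] insert.prems by auto
    then have "finite (arcs E)" using assms(1) finite_subset by blast
    moreover have "(u, v) \<notin> arcs E" "(v, u) \<notin> arcs E"
      using insert.hyps e by (auto simp: arcs_def insert_commute)
    ultimately show ?case
      using insert e by (simp add: arcs_insert)
  qed
qed

text \<open>The arcs and the diagonal are disjoint parts of the square of the vertex set. In
  consequence the membership array and the input edges together fit into array 0.\<close>

lemma edges_bound:
  assumes "E \<subseteq> all_edges {..<n::nat}"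
  shows "2 * card E + n \<le> n * n"
proof -
  let ?I = "(\<lambda>v. (v, v)) ` {..<n}"
  have "arcs E \<union> ?I \<subseteq> {..<n} \<times> {..<n}" and disj: "arcs E \<inter> ?I = {}"
    using arcs_subset[OF assms] by auto
  then have "card (arcs E \<union> ?I) \<le> card ({..<n} \<times> {..<n})"
    by (intro card_mono) auto
  moreover have "finite (arcs E)"
    using arcs_subset[OF assms] by (rule finite_subset) auto
  with disj have "card (arcs E \<union> ?I) = card (arcs E) + card ?I"
    by (intro card_Un_disjoint) auto
  moreover have "card ?I = n" by (simp add: card_image inj_on_def)
  ultimately show ?thesis
    using card_arcs_eq[OF _ assms] by simp
qed

lemma apply_update_subset:
  "E \<subseteq> all_edges V \<Longrightarrow> legal_update V E x \<Longrightarrow> apply_update x E \<subseteq> all_edges V"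
  by (cases x) auto

context word_ram
begin

section \<open>Minimality of the held set and the cost of an update sequence\<close>

lemma valid_set_reg [simp]:
  "i \<noteq> 3 \<Longrightarrow> i \<noteq> 4 \<Longrightarrow> valid F D inp (set_reg i x s) = valid F D inp s"
  by (simp add: valid_def)

text \<open>Domination says that all sets of dominators are nonempty. Removing \<open>u\<close>
  empties the set of a vertex that \<open>u\<close> alone dominates, and \<open>needed\<close>
  supplies one.\<close>

lemma valid_minimal:
  assumes "valid (arcs E) D inp s"
  shows "minimal_dominating_set {..<n} E (held_set n s)"
proof -
  from assms obtain nb where r: "rep (arcs E) D (doms (arcs E) D {}) inp nb s"
    and need: "needed (arcs E) D {} {}" and cov: "covered (arcs E) D {} = {..<n}"
    unfolding valid_def by blast
  have D: "D \<subseteq> {..<n}" by (rule rep_graph(4)[OF r])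
  have "mem s v = of_bool (v \<in> D)" if "v < n" for v
    using rep_rows(3)[OF r that] that by (simp add: arr_def)
  then have held: "held_set n s = D" using D by (auto simp: held_set_def of_bool_def split: if_splits)
  have dom: "doms (arcs E) X {} v \<noteq> {} \<longleftrightarrow> v \<in> X \<or> (\<exists>u\<in>X. {u, v} \<in> E)" for X v
    by (auto simp: doms_def arcs_def)
  have eq: "dominating_set {..<n} E X \<longleftrightarrow> X \<subseteq> {..<n} \<and> (\<forall>v<n. doms (arcs E) X {} v \<noteq> {})" for X
    unfolding dominating_set_def dom by auto
  have "dominating_set {..<n} E D"
    using cov D unfolding eq by (auto simp: covered_def)
  moreover have "\<not> dominating_set {..<n} E (D - {u})" if u: "u \<in> D" for u
  proof -
    from need u obtain w where w: "w < n" "doms (arcs E) D {} w = {u}"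
      unfolding needed_def by auto
    have "doms (arcs E) (D - {u}) {} w = doms (arcs E) D {} w - {u}"
      by (auto simp: doms_def)
    with w show ?thesis unfolding eq by auto
  qed
  ultimately show ?thesis
    unfolding held minimal_dominating_set_def by blast
qed

lemma wp_UPDATE:
  assumes valid: "valid (arcs E) D inp s" and E: "E \<subseteq> all_edges {..<n}"
    and legal: "legal_update {..<n} E x"
    and q: "\<And>i. i * (i + 1) \<le> 4 * card (apply_update x E) \<Longrightarrow> i \<le> q"
  defines "F' \<equiv> arcs (apply_update x E)"
  shows "wp W UPDATE (\<lambda>t s'. \<exists>D'. valid F' D' inp s' \<and>
    t + 160 * pot F' D' \<le> 160 * pot (arcs E) D + 600 * q + 710) (pass_update x s)"
proof -
  have q': "i \<le> q" if "i * (i + 1) \<le> 2 * card F'" for i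
    using that q card_arcs_eq[OF _ apply_update_subset[OF E legal]] by (simp add: F'_def)
  show ?thesis
  proof (cases x)
    case (InsertEdge u v)
    let ?s = "set_reg 6 1 (pass_update x s)"
    have uv: "u < n" "v < n" "u \<noteq> v" "(u, v) \<notin> arcs E"
      using legal InsertEdge by (auto simp: all_edges_def doubleton_eq_iff arcs_def)
    have F': "F' = insert (v, u) (insert (u, v) (arcs E))"
      by (simp add: F'_def InsertEdge arcs_insert)
    have 1: "wp W INSERT (\<lambda>t s'. \<exists>D'. valid F' D' inp s' \<and>
      t + 160 * pot F' D' \<le> 160 * pot (arcs E) D + 620) ?s"
      unfolding F' by (rule wp_INSERT) (use valid uv InsertEdge in auto)
    show ?thesis
      unfolding UPDATE_def using InsertEdge
      apply (simp add: wp_Seq wp_Const wp_Cond)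
      apply (rule wp_call[OF 1[unfolded InsertEdge, simplified]])
      apply auto
      done
  next
    case (DeleteEdge u v)
    let ?s = "set_reg 6 1 (pass_update x s)"
    have uv: "(u, v) \<in> arcs E"
      using legal DeleteEdge by (auto simp: arcs_def)
    have F': "F' = arcs E - {(u, v)} - {(v, u)}"
      by (simp add: F'_def DeleteEdge arcs_delete)
    have 1: "wp W DELETE (\<lambda>t s'. \<exists>D'. valid F' D' inp s' \<and>
      t + 160 * pot F' D' \<le> 160 * pot (arcs E) D + 600 * q + 700) ?s"
      unfolding F' by (rule wp_DELETE) (use valid uv DeleteEdge q' in \<open>auto simp: F'\<close>)
    show ?thesis
      unfolding UPDATE_def using DeleteEdge
      apply (simp add: wp_Seq wp_Const wp_Cond)
      apply (rule wp_call[OF 1[unfolded DeleteEdge, simplified]])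
      apply auto
      done
  qed
qed

text \<open>The potential differences telescope, leaving the initial potential as the only extra
  cost. One \<open>q\<close> has to serve every graph of the sequence.\<close>

lemma serve_UPDATE:
  assumes "valid (arcs E) D inp s" "E \<subseteq> all_edges {..<n}" "legal_updates {..<n} E us"
    and "\<And>E' i. E' \<in> set (graph_seq E us) \<Longrightarrow> i * (i + 1) \<le> 4 * card E' \<Longrightarrow> i \<le> q"
  shows "\<exists>ts ss. serve W UPDATE s us ts ss \<and>
    list_all2 (\<lambda>E s. minimal_dominating_set {..<n} E (held_set n s)) (graph_seq E us) (s # ss) \<and>
    sum_list ts \<le> 160 * pot (arcs E) D + length us * (600 * q + 710)"
  using assms
proof (induction us arbitrary: E D s)
  case Nil
  then show ?case
    using valid_minimal by (auto intro!: serve.intros(1) exI[of _ "[]"])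
next
  case (Cons x us)
  let ?E = "apply_update x E"
  have legal: "legal_update {..<n} E x" "legal_updates {..<n} ?E us"
    using Cons.prems(3) by auto
  have "?E \<in> set (graph_seq ?E us)" by (cases us) auto
  then have "i \<le> q" if "i * (i + 1) \<le> 4 * card ?E" for i
    using Cons.prems(4)[OF _ that] by simp
  from wp_UPDATE[OF Cons.prems(1,2) legal(1) this] obtain t s' D' where
    e: "exec W UPDATE (pass_update x s) t s'" and v: "valid (arcs ?E) D' inp s'"
    and t: "t + 160 * pot (arcs ?E) D' \<le> 160 * pot (arcs E) D + 600 * q + 710"
    unfolding wp_def by blast
  from Cons.IH[OF v apply_update_subset[OF Cons.prems(2) legal(1)] legal(2)] Cons.prems(4)
  obtain ts ss where "serve W UPDATE s' us ts ss"
    "list_all2 (\<lambda>E s. minimal_dominating_set {..<n} E (held_set n s)) (graph_seq ?E us) (s' # ss)"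
    "sum_list ts \<le> 160 * pot (arcs ?E) D' + length us * (600 * q + 710)"
    by auto
  with e t valid_minimal[OF Cons.prems(1)] show ?case
    by (intro exI[of _ "t # ts"] exI[of _ "s' # ss"]) (auto intro: serve.intros(2))
qed

end

section \<open>Building the start graph from the input\<close>

lemma nth_flatten:
  "i < length es \<Longrightarrow> concat (map (\<lambda>(u, v). [u, v]) es) ! (2 * i) = fst (es ! i)"
  "i < length es \<Longrightarrow> concat (map (\<lambda>(u, v). [u, v]) es) ! Suc (2 * i) = snd (es ! i)"
  by (induction es arbitrary: i) (auto simp: nth_Cons split: nat.splits prod.splits)

lemma length_flatten: "length (concat (map (\<lambda>(u, v). [u, v]) es)) = 2 * length es"
  by (induction es) auto

context word_ram
begin

lemma valid_edgeless:
  assumes "regs s 3 = n" "regs s 4 = n * n"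
    and a: "arr n s = (\<lambda>k a. if k = 0 then if a < n then 1 else inp a
      else if k = 2 \<or> k = 4 then of_bool (a < n) else if k = 3 then if a < n then a else 0 else 0)"
  shows "valid {} {..<n} inp s"
proof -
  have doms: "doms {} {..<n} {} w = (if w < n then {w} else {})" for w
    by (auto simp: doms_def)
  have "priv n (doms {} {..<n} {}) w = 1" if "w < n" for w
  proof -
    have "{v. v < n \<and> doms {} {..<n} {} v = {w}} = {w}" using that by (auto simp: doms)
    then show ?thesis by (simp add: priv_def)
  qed
  then have "rep {} {..<n} (doms {} {..<n} {}) inp (\<lambda>_. 0) s"
    using assms by (auto simp: rep_def adjrep_def domrep_def setrep_def irrefl_def doms)
  then show ?thesis
    unfolding valid_def by (auto simp: sym_def needed_def covered_def doms)
qed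

lemma wp_INIT_VERTICES:
  assumes "regs s 3 = n" "regs s 4 = n * n" "regs s 25 = 0"
    and a: "arr n s = (\<lambda>k a. if k = 0 then inp a else 0)"
  shows "wp W (While (Less 25 3) INIT_VERTEX) (\<lambda>t s'. valid {} {..<n} inp s' \<and> t \<le> 20 * n + 1) s"
proof (rule wp_While[where J = "\<lambda>t s'. regs s' 3 = n \<and> regs s' 4 = n * n \<and> (\<exists>i\<le>n. regs s' 25 = i \<and>
      t \<le> 20 * i \<and> arr n s' = (\<lambda>k a. if k = 0 then if a < i then 1 else inp a
      else if k = 2 \<or> k = 4 then of_bool (a < i) else if k = 3 then if a < i then a else 0 else 0))"
      and \<mu> = "\<lambda>s'. n - regs s' 25"], goal_cases)
  case 1
  then show ?case using assms by (auto simp: fun_eq_iff)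
next
  case (2 t s1)
  then obtain i where [simp]: "i < n" "regs s1 25 = i" and t: "t \<le> 20 * i"
    and a: "arr n s1 = (\<lambda>k a. if k = 0 then if a < i then 1 else inp a
      else if k = 2 \<or> k = 4 then of_bool (a < i) else if k = 3 then if a < i then a else 0 else 0)"
    by auto
  have [simp]: "regs s1 3 = n" "regs s1 4 = n * n" using 2 by auto
  have [simp]: "Suc i \<le> n" "n - Suc i < n - i" using \<open>i < n\<close> by linarith+
  show ?case
    unfolding INIT_VERTEX_def using t
    by (simp add: wp_simps) (auto simp: a fun_eq_iff)
next
  case (3 t s1)
  then obtain i where i: "i \<le> n" "regs s1 25 = i" "t \<le> 20 * i"
    and a: "arr n s1 = (\<lambda>k a. if k = 0 then if a < i then 1 else inp a
      else if k = 2 \<or> k = 4 then of_bool (a < i) else if k = 3 then if a < i then a else 0 else 0)"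
    by blast
  have "i = n" using 3 i(1,2) by simp
  with 3 i a have "valid {} {..<n} inp s1" by (intro valid_edgeless) simp_all
  with i(3) \<open>i = n\<close> show ?case by simp
qed

lemma wp_INIT_EDGES:
  assumes "valid {} D inp s" "regs s 25 = 0" "regs s 26 = length es" "regs s 27 = n"
    and es: "distinct (map (\<lambda>(u, v). {u, v}) es)" "set (map (\<lambda>(u, v). {u, v}) es) \<subseteq> all_edges {..<n}"
    and inp: "\<And>j. j < 2 * length es \<Longrightarrow> inp (n + j) = concat (map (\<lambda>(u, v). [u, v]) es) ! j"
  shows "wp W (While (Less 25 26) INIT_EDGE)
    (\<lambda>t s'. (\<exists>D'. valid (arcs (set (map (\<lambda>(u, v). {u, v}) es))) D' inp s') \<and>
      t \<le> 160 * pot {} D + 640 * length es + 1) s"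
proof -
  define E where "E i = set (map (\<lambda>(u, v). {u, v}) (take i es))" for i
  have len: "2 * length es + n \<le> n * n"
    using edges_bound[OF es(2)] distinct_card[OF es(1)] by simp
  show ?thesis
  proof (rule wp_While[where J = "\<lambda>t s'. \<exists>i\<le>length es. regs s' 25 = i \<and> regs s' 26 = length es \<and>
      regs s' 27 = n + 2 * i \<and> (\<exists>D'. valid (arcs (E i)) D' inp s' \<and>
      t + 160 * pot (arcs (E i)) D' \<le> 160 * pot {} D + 640 * i)"
      and \<mu> = "\<lambda>s'. length es - regs s' 25"], goal_cases)
    case 1
    then show ?case using assms by (auto simp: E_def arcs_empty)
  next
    case (2 t s1)
    then obtain i D1 where i: "i < length es" and [simp]: "regs s1 25 = i" "regs s1 26 = length es"
      "regs s1 27 = n + 2 * i" and v: "valid (arcs (E i)) D1 inp s1"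
      and t: "t + 160 * pot (arcs (E i)) D1 \<le> 160 * pot {} D + 640 * i"
      by auto
    obtain x y where xy: "es ! i = (x, y)" by fastforce
    have ES: "E (Suc i) = insert {x, y} (E i)"
      using i xy by (simp add: E_def take_Suc_conv_app_nth)
    have "es ! i \<in> set es" using i by simp
    then have "{x, y} \<in> all_edges {..<n}" using es(2) xy by force
    then have [simp]: "x < n" "y < n" "x \<noteq> y"
      by (auto simp: all_edges_def doubleton_eq_iff)
    \<comment> \<open>Distinctness of the edges as sets guarantees that the next edge is absent so
      far, in either orientation.\<close>
    have "distinct (map (\<lambda>(u, v). {u, v}) (take (Suc i) es))"
      using es(1) by (metis distinct_take take_map)
    then have new: "(x, y) \<notin> arcs (E i)"
      using i xy by (auto simp: E_def take_Suc_conv_app_nth arcs_def)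
    from v obtain nb where r: "rep (arcs (E i)) D1 (doms (arcs (E i)) D1 {}) inp nb s1"
      unfolding valid_def by blast
    have lt: "n + 2 * i < n * n" "Suc (n + 2 * i) < n * n" using len i by auto
    then have [simp]: "n + 2 * i < n * n" "Suc (n + 2 * i) < n * n" "Suc (n + 2 * i) < W"
      "Suc (Suc (n + 2 * i)) < W"
      by (auto intro!: less_W)
    have "Suc i < n * n" using len i \<open>x < n\<close> by linarith
    then have [simp]: "Suc i < W" by (auto intro: less_W)
    have [simp]: "arr n s1 0 (n + 2 * i) = x" "arr n s1 0 (Suc (n + 2 * i)) = y"
      using r inp[of "2 * i"] inp[of "Suc (2 * i)"] i nth_flatten[OF i] xy
      by (auto simp: rep_def setrep_def)
    have [simp]: "regs s1 3 = n" "regs s1 4 = n * n" using rep_regs[OF r] by auto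
    let ?F = "arcs (E (Suc i))"
    have F: "?F = insert (y, x) (insert (x, y) (arcs (E i)))"
      by (simp add: ES arcs_insert)
    have ins: "wp W INSERT (\<lambda>t s'. \<exists>D'. valid ?F D' inp s' \<and>
      t + 160 * pot ?F D' \<le> 160 * pot (arcs (E i)) D1 + 620) s'"
      if "valid (arcs (E i)) D1 inp s'" "regs s' 1 = x" "regs s' 2 = y" for s'
      unfolding F by (rule wp_INSERT) (use that new in auto)
    show ?case
      unfolding INIT_EDGE_def
      apply (simp add: wp_simps)
      apply (rule wp_call[OF ins])
         apply (use v in auto)[3]
      apply (elim exE conjE)
      subgoal for t' s' D'
        using i t by (auto simp: wp_simps intro!: exI[of _ D'])
      done
  next
    case (3 t s1)
    then show ?case by (auto simp: E_def)
  qed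
qed

lemma wp_INIT:
  assumes E: "simple_graph {..<n} E" and es: "edge_list E es"
  shows "wp W INIT (\<lambda>t s'. \<exists>D inp. valid (arcs E) D inp s' \<and> t \<le> 20 * n + 640 * card E + 20)
    (input_state n es)"
proof -
  let ?xs = "concat (map (\<lambda>(u, v). [u, v]) es)"
  have E': "E \<subseteq> all_edges {..<n}" using E by (simp add: simple_graph_def)
  have es': "distinct (map (\<lambda>(u, v). {u, v}) es)" "set (map (\<lambda>(u, v). {u, v}) es) = E"
    using es by (auto simp: edge_list_def)
  have card: "card E = length es" using distinct_card[OF es'(1)] es'(2) by simp
  have len: "2 * length es + n \<le> n * n" using edges_bound[OF E'] card by simp
  define inp where "inp = arr n (input_state n es) 0"
  have regs: "regs (input_state n es) 0 = n" "regs (input_state n es) (Suc 0) = length es"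
    by (auto simp: input_state_def Let_def)
  have mem: "mem (input_state n es) a = (if n \<le> a \<and> a < n + 2 * length es then ?xs ! (a - n) else 0)" for a
    by (simp add: input_state_def Let_def length_flatten)
  \<comment> \<open>The input lies entirely inside array 0, so all other arrays start out as
    zero.\<close>
  have "arr n (input_state n es) k a = 0" if "k \<noteq> 0" for k a
  proof -
    have "n * n \<le> k * (n * n)" using that by simp
    then have "n + 2 * length es \<le> k * (n * n) + a" using len by linarith
    then show ?thesis by (simp add: arr_def mem)
  qed
  then have a: "arr n (input_state n es) = (\<lambda>k a. if k = 0 then inp a else 0)"
    by (auto simp: inp_def fun_eq_iff)
  have inp: "inp (n + j) = ?xs ! j" if "j < 2 * length es" for j
    using that len by (simp add: inp_def arr_def mem)
  have [simp]: "n * n < W" "n < W" "length es < W" using len by (auto intro!: less_W)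
  have pot0: "pot {} {..<n} = 0" by (simp add: pot_def)
  show ?thesis
    unfolding INIT_def
    apply (simp add: wp_simps regs)
    apply (rule wp_call[OF wp_INIT_VERTICES[where inp = inp]])
        apply (simp_all add: a)[4]
    apply (simp add: wp_simps)
    apply (rule wp_call[OF wp_INIT_EDGES[where inp = inp and D = "{..<n}" and es = es]])
          apply (use inp es' E' in \<open>simp_all add: INIT_VERTEX_def\<close>)[7]
    apply (use es'(2) in \<open>auto simp: card pot0\<close>)
    done
qed

text \<open>Bounds the potential left by the initialisation, which is the source of the
  \<open>card E0\<close> term in the total update time.\<close>

lemma valid_pot:
  assumes "valid (arcs E) D inp s" "E \<subseteq> all_edges {..<n}"
  shows "pot (arcs E) D \<le> 2 * card E"
proof -
  from assms obtain nb where r: "rep (arcs E) D (doms (arcs E) D {}) inp nb s"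
    unfolding valid_def by blast
  have "pot (arcs E) D \<le> (\<Sum>v<n. card (arcs E `` {v}))"
    unfolding pot_def by (rule sum_mono2) (use rep_graph(4)[OF r] in auto)
  also have "\<dots> = card (arcs E)"
    by (rule card_arcs[symmetric]) (rule rep_graph(1)[OF r])
  finally show ?thesis using card_arcs_eq[OF _ assms(2)] by simp
qed

end

text \<open>The graph before or after the first update has an edge. Hence \<open>m \<ge> 1\<close>
  as soon as there is an update, and the constant cost of an update is absorbed by
  \<open>sqrt (real m)\<close>.\<close>

lemma legal_updates_edge:
  assumes "finite V" "E \<subseteq> all_edges V" "legal_updates V E us" "us \<noteq> []"
  shows "\<exists>E'\<in>set (graph_seq E us). 1 \<le> card E'"
proof -
  obtain x xs where us: "us = x # xs" using assms(4) by (cases us) auto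
  have fin: "finite E'" if "E' \<subseteq> all_edges V" for E'
    using that finite_all_edges[OF assms(1)] finite_subset by blast
  have legal: "legal_update V E x" using assms(3) us by simp
  have "E \<noteq> {} \<or> apply_update x E \<noteq> {}"
    using legal by (cases x) auto
  moreover have "apply_update x E \<in> set (graph_seq E us)" "E \<in> set (graph_seq E us)"
    unfolding us by (cases xs; simp)+
  ultimately show ?thesis
    using fin[OF assms(2)] fin[OF apply_update_subset[OF assms(2) legal]]
    by (metis One_nat_def Suc_leI card_gt_0_iff)
qed

theorem theorem2:
  "\<exists>(init :: com) (upd :: com) (c :: nat) (C :: real).
     \<forall>(n :: nat) (E0 :: nat set set) (es :: (nat \<times> nat) list) (us :: nat update list) (m :: nat).
       simple_graph {..<n} E0 \<longrightarrow> edge_list E0 es \<longrightarrow> legal_updates {..<n} E0 us \<longrightarrow>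
       (\<forall>E \<in> set (graph_seq E0 us). card E \<le> m) \<longrightarrow>
       (\<exists>t0 s0 ts ss.
          exec ((n + 2) ^ c) init (input_state n es) t0 s0 \<and>
          serve ((n + 2) ^ c) upd s0 us ts ss \<and>
          list_all2 (\<lambda>E s. minimal_dominating_set {..<n} E (held_set n s))
            (graph_seq E0 us) (s0 # ss) \<and>
          real t0 \<le> C * real (n + card E0 + 1) \<and>
          real (sum_list ts) \<le> C * (real (card E0) + real (length us) * sqrt (real m)))"
proof (rule exI[of _ INIT], rule exI[of _ UPDATE], rule exI[of _ 5], rule exI[of _ 2000],
    intro allI impI)
  fix n :: nat and E0 es us and m :: nat
  assume g: "simple_graph {..<n} E0" and es: "edge_list E0 es"
    and legal: "legal_updates {..<n} E0 us" and m: "\<forall>E\<in>set (graph_seq E0 us). card E \<le> m"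
  let ?W = "(n + 2) ^ 5"
  interpret word_ram n ?W
  proof
    \<comment> \<open>\<open>8 = 2 ^ 3\<close> is at most \<open>(n + 2) ^ 3\<close>, which explains
      the exponent 5.\<close>
    have "8 * (n * n) + 32 * n + 32 = (n + 2) ^ 2 * 2 ^ 3"
      by (simp add: power2_eq_square algebra_simps)
    also have "\<dots> \<le> (n + 2) ^ 2 * (n + 2) ^ 3"
      by (intro mult_left_mono power_mono) auto
    finally show "8 * (n * n) + 32 * n + 32 \<le> ?W"
      by (simp flip: power_add)
  qed
  have E0: "E0 \<subseteq> all_edges {..<n}" using g by (simp add: simple_graph_def)
  from wp_INIT[OF g es] obtain t0 s0 D inp where e: "exec ?W INIT (input_state n es) t0 s0"
    and v: "valid (arcs E0) D inp s0" and t0: "t0 \<le> 20 * n + 640 * card E0 + 20"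
    unfolding wp_def by blast
  \<comment> \<open>From \<open>i * (i + 1) \<le> 4 * m\<close> follows
    \<open>i ^ 2 \<le> 4 * m\<close>, that is, \<open>i\<close> is at most twice the root of
    \<open>m\<close>.\<close>
  define q where "q = nat \<lfloor>2 * sqrt (real m)\<rfloor>"
  have q: "i \<le> q" if "E \<in> set (graph_seq E0 us)" "i * (i + 1) \<le> 4 * card E" for E i
  proof -
    have "i * i \<le> 4 * m" using m that by fastforce
    then have "real i ^ 2 \<le> 4 * real m"
      unfolding power2_eq_square by (metis of_nat_le_iff of_nat_mult of_nat_numeral)
    then have "real i \<le> sqrt (4 * real m)" by (rule real_le_rsqrt)
    then have "real i \<le> 2 * sqrt (real m)" by (simp add: real_sqrt_mult)
    then show ?thesis unfolding q_def by linarith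
  qed
  from serve_UPDATE[OF v E0 legal, of q] q obtain ts ss where s: "serve ?W UPDATE s0 us ts ss"
    "list_all2 (\<lambda>E s. minimal_dominating_set {..<n} E (held_set n s)) (graph_seq E0 us) (s0 # ss)"
    and ts: "sum_list ts \<le> 160 * pot (arcs E0) D + length us * (600 * q + 710)"
    by blast
  have "real (length us) * (600 * real q + 710) \<le> 2000 * (real (length us) * sqrt (real m))"
  proof (cases "us = []")
    case False
    then have "1 \<le> m"
      using legal_updates_edge[OF _ E0 legal] m by (meson finite_lessThan le_trans)
    then have "1 \<le> sqrt (real m)" by simp
    moreover have "real q \<le> 2 * sqrt (real m)" unfolding q_def by simp
    \<comment> \<open>With \<open>sqrt (real m) \<ge> 1\<close> the coefficient is
      \<open>2 * 600 + 710 = 1910\<close>.\<close>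
    ultimately have "600 * real q + 710 \<le> 2000 * sqrt (real m)" by linarith
    then have "real (length us) * (600 * real q + 710) \<le> real (length us) * (2000 * sqrt (real m))"
      by (rule mult_left_mono) simp
    then show ?thesis by (simp add: ac_simps)
  qed simp
  \<comment> \<open>320 is the rate 160 times the initial potential of at most
    \<open>2 * card E0\<close>.\<close>
  moreover have "sum_list ts \<le> 320 * card E0 + length us * (600 * q + 710)"
    using ts valid_pot[OF v E0] by linarith
  then have "real (sum_list ts) \<le> real (320 * card E0 + length us * (600 * q + 710))"
    by (rule of_nat_mono)
  ultimately have "real (sum_list ts) \<le> 2000 * (real (card E0) + real (length us) * sqrt (real m))"
    by simp
  moreover have "real t0 \<le> 2000 * real (n + card E0 + 1)"
    using t0 by simp
  ultimately show "\<exists>t0 s0 ts ss. exec ?W INIT (input_state n es) t0 s0 \<and>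
      serve ?W UPDATE s0 us ts ss \<and>
      list_all2 (\<lambda>E s. minimal_dominating_set {..<n} E (held_set n s)) (graph_seq E0 us) (s0 # ss) \<and>
      real t0 \<le> 2000 * real (n + card E0 + 1) \<and>
      real (sum_list ts) \<le> 2000 * (real (card E0) + real (length us) * sqrt (real m))"
    using e s by blast
qed

end
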